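(* Let $X(t)=(X_1(t),\ldots,X_n(t))$ where $X_1,\ldots,X_n$ are (possibly degenerate) Lévy processes on $\mathbb{R}$ with $X(0)=0$, let $V=(V_1,\ldots,V_n):\mathbb{R}^n\to\mathbb{R}^n$ be locally Lipschitz, and for $x\in\mathbb{R}^n$ let $Y^x(t)$ be the solution of $$dY_i(t)=dX_i(t)+V_i(Y(t))\,dt,\quad i=1,\ldots,n,\qquad Y(0)=x.$$ Fix $0<t_0<\infty$. Assume that the explosion time satisfies $\zeta(x,\omega)=\infty$ for all $x\in\mathbb{R}^n$ and all $\omega\in\Omega$. Let $K\subset\mathbb{R}^n$ and set $K_r=\bigcup_{x\in K}B^*(x,r)$ for $r=1,2,3$. Assume that there exists a convex set $M\subset\mathbb{R}^n$ such that $Y^x(t,\omega)\in M$ for all $x\in K_3$, all $t\le t_0$ and all $\omega\in\Omega$. Assume that $\|V\|_{(3),M}<\infty$. Put $$\tau:=\frac{1}{2\,\|D^{(1)}V\|_{\infty,M}}\wedge t_0\qquad\left(\tfrac10:=\infty\right).$$ Then for every $\omega\in\Omega$ the following hold. (i) For all $0<t\le\tau$, $x\in K_2$, $h\in\mathbb{R}^n$ with $\|h\|<1$, $$\|Y^{x+h}(t,\omega)-Y^x(t,\omega)\|\le2\|h\|.$$ (ii) For all $0<t\le\tau$, $x\in K_2$, $i\in\{1,\ldots,n\}$, the limit $$D_iY^x(t,\omega):=\lim_{u\to0}\frac{Y^{x+ue_i}(t,\omega)-Y^x(t,\omega)}{u}$$ exists, and $\|D_iY^x(t,\omega)\|\le2$.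 (iii) For all $0<t\le\tau$, $x\in K_1$, $h\in\mathbb{R}^n$ with $\|h\|<1$, $i\in\{1,\ldots,n\}$, $$\|D_iY^{x+h}(t,\omega)-D_iY^x(t,\omega)\|\le8\,\|D^{(2)}V\|_{\infty,M}\,\tau\,\|h\|.$$ (iv) For all $0<t\le\tau$, $x\in K_1$, $i,k\in\{1,\ldots,n\}$, the limit $$D_{ik}Y^x(t,\omega):=\lim_{u\to0}\frac{D_iY^{x+ue_k}(t,\omega)-D_iY^x(t,\omega)}{u}$$ exists, and $\|D_{ik}Y^x(t,\omega)\|\le8\,\|D^{(2)}V\|_{\infty,M}\,\tau$. (v) For all $0<t\le\tau$, $x\in K$, $h\in\mathbb{R}^n$ with $\|h\|<1$, $i,k\in\{1,\ldots,n\}$, $$\|D_{ik}Y^{x+h}(t,\omega)-D_{ik}Y^x(t,\omega)\|\le96\,\|D^{(2)}V\|_{\infty,M}^2\,\tau^2\,\|h\|+16\,\|D^{(3)}V\|_{\infty,M}\,\tau\,\|h\|.$$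
   Context: The probability space $\Omega$ is such that the equation holds for every $\omega$: $X(0)=0$ and $Y^x(t)=x+X(t)+\int_0^tV(Y^x(s))\,ds$ for all $t\ge0$ and all $\omega\in\Omega$. The explosion time $\zeta(x,\omega)\in[0,\infty]$ is the stopping time up to which the unique solution started at $x$ exists, with $\limsup_{t\to\zeta}|Y^x(t)|=\infty$ a.s. on $\{\zeta<\infty\}$. Some or all of the $X_i$ may be identically $0$. $e_i$ is the $i$-th standard unit vector of $\mathbb{R}^n$; $a\wedge b=\min(a,b)$. $\|x\|=\max_i|x_i|$ for $x\in\mathbb{R}^n$ and $B^*(x,r)=\{y\in\mathbb{R}^n:\|y-x\|<r\}$. For $A\subset\mathbb{R}^n$, $\|V\|_{\infty,A}=\sum_{i=1}^n\sup_{x\in A}|V_i(x)|$, $\|D^{(j)}V\|_{\infty,A}=\sum_{i=1}^n\sum_{|\alpha|=j}\sup_{x\in A}|D^\alpha V_i(x)|$ (inner sum over multi-indices $\alpha\in\mathbb{N}_0^n$), and $\|V\|_{(j),A}=\|V\|_{\infty,A}+\|D^{(1)}V\|_{\infty,A}+\cdots+\|D^{(j)}V\|_{\infty,A}$. *)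

theory Defs
  imports "HOL-Probability.Probability"
begin

(* The max norm of the source is the library's infnorm (see infnorm_cart). *)

definition Bstar :: "real^'n \<Rightarrow> real \<Rightarrow> (real^'n) set" where
  "Bstar x r = {y. infnorm (y - x) < r}"

definition enlarge :: "(real^'n) set \<Rightarrow> real \<Rightarrow> (real^'n) set" where
  "enlarge K r = (\<Union>x\<in>K. Bstar x r)"

definition locally_Lipschitz :: "('a::metric_space \<Rightarrow> 'b::metric_space) \<Rightarrow> bool" where
  "locally_Lipschitz V \<longleftrightarrow> (\<forall>x. \<exists>r>0. \<exists>L. L-lipschitz_on (cball x r) V)"


(* Degenerate processes (e.g. the zero process) are allowed. *)

definition levy_process :: "'w measure \<Rightarrow> (real \<Rightarrow> 'w \<Rightarrow> real) \<Rightarrow> bool" where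
  "levy_process P X \<longleftrightarrow>
     (\<forall>t\<ge>0. X t \<in> borel_measurable P) \<and>
     (AE \<omega> in P. X 0 \<omega> = 0) \<and>
     (\<forall>(m::nat) (t::nat \<Rightarrow> real). 0 \<le> t 0 \<and> (\<forall>k<m. t k \<le> t (Suc k)) \<longrightarrow>
        prob_space.indep_vars P (\<lambda>_. borel) (\<lambda>k \<omega>. X (t (Suc k)) \<omega> - X (t k) \<omega>) {..<m}) \<and>
     (\<forall>s\<ge>0. \<forall>t\<ge>0. distr P borel (\<lambda>\<omega>. X (s + t) \<omega> - X s \<omega>) = distr P borel (X t)) \<and>
     (\<forall>t\<ge>0. \<forall>\<epsilon>>0.
        ((\<lambda>s. measure P {\<omega> \<in> space P. \<bar>X s \<omega> - X t \<omega>\<bar> > \<epsilon>}) \<longlongrightarrow> 0) (at t within {0..})) \<and>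
     (AE \<omega> in P. \<forall>t\<ge>0. continuous (at_right t) (\<lambda>s. X s \<omega>) \<and>
        (t > 0 \<longrightarrow> (\<exists>l. ((\<lambda>s. X s \<omega>) \<longlongrightarrow> l) (at_left t))))"


(* The SDE has additive noise, so it is solved separately along each driving path p = X(.,\<omega>). *)

definition solution_upto ::
  "(real \<Rightarrow> real^'n) \<Rightarrow> (real^'n \<Rightarrow> real^'n) \<Rightarrow> real^'n \<Rightarrow> ereal \<Rightarrow> (real \<Rightarrow> real^'n) \<Rightarrow> bool" where
  "solution_upto p V x T y \<longleftrightarrow>
     (\<forall>t\<ge>0. ereal t < T \<longrightarrow>
        (\<lambda>s. V (y s)) absolutely_integrable_on {0..t} \<and>
        y t = x + p t + integral {0..t} (\<lambda>s. V (y s)))"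

definition explosion_time ::
  "(real \<Rightarrow> real^'n) \<Rightarrow> (real^'n \<Rightarrow> real^'n) \<Rightarrow> real^'n \<Rightarrow> ereal" where
  "explosion_time p V x =
     Sup {T. 0 \<le> T \<and> (\<exists>y. solution_upto p V x T y \<and>
            (\<forall>z. solution_upto p V x T z \<longrightarrow> (\<forall>t\<ge>0. ereal t < T \<longrightarrow> z t = y t)))}"


(* D_i of a map with values in a normed space, as a limit of difference quotients.  The value
   partial i f x is meaningful only together with partial_exists i f x. *)

definition partial_exists ::
  "'n::finite \<Rightarrow> (real^'n \<Rightarrow> 'b::real_normed_vector) \<Rightarrow> real^'n \<Rightarrow> bool" where
  "partial_exists i f x \<longleftrightarrow>
     (\<exists>l. ((\<lambda>u::real. (f (x + u *\<^sub>R axis i 1) - f x) /\<^sub>R u) \<longlongrightarrow> l) (at 0))"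

definition partial ::
  "'n::finite \<Rightarrow> (real^'n \<Rightarrow> 'b::real_normed_vector) \<Rightarrow> real^'n \<Rightarrow> 'b" where
  "partial i f x = Lim (at 0) (\<lambda>u::real. (f (x + u *\<^sub>R axis i 1) - f x) /\<^sub>R u)"


(* has_iterated_partial [i1,...,ik] f x d: the derivative d_{i1} ... d_{ik} f exists at x and
   equals d (the last index is differentiated first).  The inner derivative is required to exist
   at the points x + u e_{i1} for all small u, so no default value can enter. *)

fun has_iterated_partial :: "'n::finite list \<Rightarrow> (real^'n \<Rightarrow> real) \<Rightarrow> real^'n \<Rightarrow> real \<Rightarrow> bool" where
  "has_iterated_partial [] f x d \<longleftrightarrow> f x = d"
| "has_iterated_partial (i # is) f x d \<longleftrightarrow>
     (\<exists>g. (\<forall>\<^sub>F u in nhds (0::real). has_iterated_partial is f (x + u *\<^sub>R axis i 1) (g u)) \<and>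
          (g has_real_derivative d) (at 0))"

(* D^\<alpha> f(x) for a multi-index \<alpha>.  The notation presupposes that the order of differentiation is
   irrelevant: every ordering of \<alpha> must give an existing iterated derivative with the same value.
   Continuity of the derivatives is not required. *)

definition has_multi_partial ::
  "('n::finite \<Rightarrow> nat) \<Rightarrow> (real^'n \<Rightarrow> real) \<Rightarrow> real^'n \<Rightarrow> real \<Rightarrow> bool" where
  "has_multi_partial \<alpha> f x d \<longleftrightarrow>
     (\<forall>is. (\<forall>i. count_list is i = \<alpha> i) \<longrightarrow> has_iterated_partial is f x d)"

definition multi_partial :: "('n::finite \<Rightarrow> nat) \<Rightarrow> (real^'n \<Rightarrow> real) \<Rightarrow> real^'n \<Rightarrow> real" where
  "multi_partial \<alpha> f x = (THE d. has_multi_partial \<alpha> f x d)"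

definition partials_exist_upto :: "nat \<Rightarrow> (real^'n \<Rightarrow> real^'n) \<Rightarrow> (real^'n) set \<Rightarrow> bool" where
  "partials_exist_upto m V A \<longleftrightarrow>
     (\<forall>i. \<forall>\<alpha>::'n \<Rightarrow> nat. (\<Sum>k\<in>UNIV. \<alpha> k) \<le> m \<longrightarrow>
        (\<forall>x\<in>A. \<exists>d. has_multi_partial \<alpha> (\<lambda>y. V y $ i) x d))"

definition supn :: "(real^'n \<Rightarrow> real^'n) \<Rightarrow> (real^'n) set \<Rightarrow> ennreal" where
  "supn V A = (\<Sum>i\<in>UNIV. SUP x\<in>A. ennreal \<bar>V x $ i\<bar>)"

definition Dsupn :: "nat \<Rightarrow> (real^'n \<Rightarrow> real^'n) \<Rightarrow> (real^'n) set \<Rightarrow> ennreal" where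
  "Dsupn j V A =
     (\<Sum>i\<in>UNIV. \<Sum>\<alpha>\<in>{\<alpha>::'n \<Rightarrow> nat. (\<Sum>k\<in>UNIV. \<alpha> k) = j}.
        SUP x\<in>A. ennreal \<bar>multi_partial \<alpha> (\<lambda>y. V y $ i) x\<bar>)"

definition Cnorm :: "nat \<Rightarrow> (real^'n \<Rightarrow> real^'n) \<Rightarrow> (real^'n) set \<Rightarrow> ennreal" where
  "Cnorm j V A = supn V A + (\<Sum>l=1..j. Dsupn l V A)"

end

(* The noise cancels in differences of solutions, so for each \<omega> the increments of Y in x solve
   integral equations along a deterministic flow. On [0, \<tau>] the derivative of V contributes at
   most half of the supremum of the solution, which can therefore be absorbed; this gives all the
   bounds. The difference quotients of Y, and then those of D_i Y, solve such equations up to an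
   error O(u), hence they are Cauchy as u tends to 0, and their limits solve the first and second
   variational equation. Working with limits of quotients also avoids measurability questions about
   s \<mapsto> DV(Y(s)). The exact constants come out if D_i Y and D_ik Y are measured in the l1 norm and
   only the increments of Y in the max norm: no multinomial factors arise in the sums over
   multi-indices. *)

theory Submission
  imports Defs
begin

text \<open>The partial derivatives of \<open>V\<close> are known to exist and to be bounded on
  \<open>M\<close>, but \<open>M\<close> need not be open and the highest derivatives need not be
  continuous. All regularity of \<open>V\<close> is therefore extracted from bounds: a bound at
  order j + 1 makes the derivatives of order j Lipschitz on open convex sets, and Lipschitz first
  derivatives of a map give it a quadratic Taylor remainder. The remainder for DV is what calls for
  order three. These estimates live in the interior of \<open>M\<close>, so trajectories must be
  kept there. That argument needs a Lipschitz flow, hence a Lipschitz \<open>V\<close> on all of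
  \<open>M\<close>. The circle is broken by convexity: \<open>M\<close> lies in the closure of its
  interior, and continuity of \<open>V\<close> carries the bound over. The constants are products of
  twos: one for each absorption, one for each increment of Y, one for each factor D_i Y. The Taylor
  constants only govern the rate at which quotients converge and vanish in the limit. Each
  differentiation or increment in x costs one unit of enlargement, whence K_3, K_2, K_1.\<close>

section \<open>The l1 norm and its duality with the max norm\<close>

definition l1 :: "real^'n \<Rightarrow> real" where
  "l1 v = (\<Sum>k\<in>UNIV. \<bar>v $ k\<bar>)"

lemma l1_nonneg [simp]: "0 \<le> l1 v"
  by (simp add: l1_def sum_nonneg)

lemma l1_zero [simp]: "l1 0 = 0"
  by (simp add: l1_def)

lemma l1_minus [simp]: "l1 (- v) = l1 v"
  by (simp add: l1_def)

lemma l1_scaleR [simp]: "l1 (c *\<^sub>R v) = \<bar>c\<bar> * l1 v"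
  by (simp add: l1_def abs_mult sum_distrib_left)

lemma l1_triangle: "l1 (v + w) \<le> l1 v + l1 w"
  unfolding l1_def sum.distrib [symmetric] by (intro sum_mono) auto

lemma l1_add_le: "l1 v \<le> a \<Longrightarrow> l1 w \<le> b \<Longrightarrow> l1 (v + w) \<le> a + b"
  using l1_triangle [of v w] by linarith

lemma l1_diff_le: "l1 v \<le> a \<Longrightarrow> l1 w \<le> b \<Longrightarrow> l1 (v - w) \<le> a + b"
  using l1_add_le [of v a "- w" b] by simp

lemma l1_sum: "l1 (\<Sum>k\<in>A. f k) \<le> (\<Sum>k\<in>A. l1 (f k))"
proof (induction A rule: infinite_finite_induct)
  case (insert x A)
  then show ?case
    using l1_triangle [of "f x" "\<Sum>k\<in>A. f k"] by simp
qed auto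

lemma l1_axis [simp]: "l1 (axis i 1) = 1"
proof -
  have "l1 (axis i 1) = (\<Sum>k\<in>UNIV. if k = i then 1 else 0)"
    unfolding l1_def axis_def by (intro sum.cong) auto
  then show ?thesis by simp
qed

lemma infnorm_le_l1: "infnorm v \<le> l1 v"
proof -
  have "\<bar>v $ k\<bar> \<le> l1 v" for k
    unfolding l1_def by (rule member_le_sum) auto
  then show ?thesis
    unfolding infnorm_cart by (intro cSup_least) auto
qed

lemma infnorm_axis [simp]: "infnorm (axis i (1::real)) = 1"
proof (rule antisym)
  show "infnorm (axis i (1::real)) \<le> 1"
    using infnorm_le_l1 [of "axis i 1"] by simp
  show "1 \<le> infnorm (axis i (1::real))"
    using component_le_infnorm_cart [of "axis i (1::real)" i] by simp
qed

lemma norm_le_l1: "norm v \<le> l1 v"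
  unfolding l1_def by (rule norm_le_l1_cart)

lemma infnorm_scaleR [simp]: "infnorm (c *\<^sub>R v) = \<bar>c\<bar> * infnorm v"
  by (rule infnorm_mul)

lemma inner_le_l1:
  assumes "\<And>k. \<bar>w $ k\<bar> \<le> 1"
  shows "\<bar>w \<bullet> v\<bar> \<le> l1 v"
proof -
  have "\<bar>w \<bullet> v\<bar> \<le> (\<Sum>k\<in>UNIV. \<bar>w $ k * v $ k\<bar>)"
    unfolding inner_vec_def by (simp add: sum_abs)
  also have "\<dots> \<le> l1 v"
    unfolding l1_def using assms by (intro sum_mono) (simp add: abs_mult mult_left_le_one_le)
  finally show ?thesis .
qed

text \<open>The sign vector of \<open>v\<close> attains the dual norm. Pairing with it reduces
  vector-valued integral and mean value estimates to scalar ones without a dimensional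
  factor.\<close>

lemma l1_eq_inner:
  fixes v :: "real^'n"
  obtains w where "\<And>k. \<bar>w $ k\<bar> \<le> 1" "w \<bullet> v = l1 v"
proof
  show "\<bar>(\<chi> k. sgn (v $ k)) $ k\<bar> \<le> 1" for k
    by (simp add: abs_sgn_eq)
  show "(\<chi> k. sgn (v $ k)) \<bullet> v = l1 v"
    unfolding inner_vec_def l1_def by (intro sum.cong) (auto simp: sgn_if)
qed

lemma continuous_on_l1 [continuous_intros]:
  "continuous_on S f \<Longrightarrow> continuous_on S (\<lambda>x. l1 (f x))"
  unfolding l1_def by (intro continuous_intros)

lemma l1_tendsto_at_0:
  fixes f :: "real \<Rightarrow> real^'n"
  assumes "0 < r" and bnd: "\<And>u. 0 < \<bar>u\<bar> \<Longrightarrow> \<bar>u\<bar> < r \<Longrightarrow> l1 (f u - L) \<le> E * \<bar>u\<bar>"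
  shows "(f \<longlongrightarrow> L) (at 0)"
proof (rule LIM_zero_cancel, rule Lim_null_comparison)
  show "((\<lambda>u. E * \<bar>u\<bar>) \<longlongrightarrow> 0) (at 0)"
    by (auto intro!: tendsto_eq_intros)
  show "\<forall>\<^sub>F u in at 0. norm (f u - L) \<le> E * \<bar>u\<bar>"
    unfolding eventually_at
    using \<open>0 < r\<close> bnd by (intro exI [of _ r]) (force intro: order_trans [OF norm_le_l1])
qed

lemma l1_sum_scaleR:
  assumes "\<And>k. l1 (G k) \<le> D"
  shows "l1 (\<Sum>k\<in>UNIV. v $ k *\<^sub>R G k) \<le> D * l1 v"
proof -
  have "l1 (\<Sum>k\<in>UNIV. v $ k *\<^sub>R G k) \<le> (\<Sum>k\<in>UNIV. \<bar>v $ k\<bar> * D)"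
    by (rule order_trans [OF l1_sum]) (auto intro!: sum_mono mult_left_mono assms)
  then show ?thesis
    by (simp add: l1_def sum_distrib_left mult.commute)
qed

lemma l1_sum_scaleR_infnorm:
  assumes "\<And>k. l1 (G k) \<le> \<beta> k" "(\<Sum>k\<in>UNIV. \<beta> k) \<le> D"
  shows "l1 (\<Sum>k\<in>UNIV. v $ k *\<^sub>R G k) \<le> D * infnorm v"
proof -
  have "l1 (\<Sum>k\<in>UNIV. v $ k *\<^sub>R G k) \<le> (\<Sum>k\<in>UNIV. infnorm v * \<beta> k)"
    by (rule order_trans [OF l1_sum])
      (auto intro!: sum_mono mult_mono assms component_le_infnorm_cart infnorm_pos_le)
  also have "\<dots> \<le> D * infnorm v"
    using mult_right_mono [OF assms(2) infnorm_pos_le [of v]]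
    by (simp add: sum_distrib_left mult.commute)
  finally show ?thesis .
qed

section \<open>Integral equations on a short interval\<close>

lemma integrable_on_initial_segment:
  fixes f :: "real \<Rightarrow> 'a::banach"
  assumes "f integrable_on {0..\<tau>}" "t \<in> {0..\<tau>}"
  shows "f integrable_on {0..t}"
  using integrable_on_subinterval [OF assms(1), of 0 t] assms(2) by auto

lemma l1_integral_le:
  fixes f :: "real \<Rightarrow> real^'n"
  assumes "f integrable_on {a..b}" "a \<le> b" "\<And>s. s \<in> {a..b} \<Longrightarrow> l1 (f s) \<le> B"
  shows "l1 (integral {a..b} f) \<le> B * (b - a)"
proof -
  obtain w where w: "\<And>k. \<bar>w $ k\<bar> \<le> 1" "w \<bullet> integral {a..b} f = l1 (integral {a..b} f)"
    using l1_eq_inner by blast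
  have hi: "((\<lambda>s. w \<bullet> f s) has_integral w \<bullet> integral {a..b} f) {a..b}"
    using has_integral_linear [OF integrable_integral [OF assms(1)] bounded_linear_inner_right [of w]]
    by (simp add: o_def)
  have "w \<bullet> integral {a..b} f \<le> B * (b - a)"
  proof (rule has_integral_le [OF hi])
    show "((\<lambda>s. B) has_integral B * (b - a)) {a..b}"
      using has_integral_const_real [of B a b] \<open>a \<le> b\<close> by (simp add: mult.commute)
    show "w \<bullet> f s \<le> B" if "s \<in> {a..b}" for s
      using inner_le_l1 [OF w(1), of "f s"] assms(3) [OF that] by linarith
  qed
  with w(2) show ?thesis by simp
qed

(* Since the total growth D \<tau> is at most 1/2, the supremum of f absorbs itself; this replaces
   Gronwall's lemma and gives the constants of the theorem. *)
lemma half_absorption: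
  fixes f :: "real \<Rightarrow> real" and z :: "real \<Rightarrow> real^'n"
  assumes "0 \<le> D" "D * \<tau> \<le> 1/2" "0 \<le> M"
    and bdd: "\<And>t. t \<in> {0..\<tau>} \<Longrightarrow> f t \<le> R"
    and nonneg: "\<And>t. t \<in> {0..\<tau>} \<Longrightarrow> 0 \<le> f t"
    and ab: "\<And>t. t \<in> {0..\<tau>} \<Longrightarrow> 0 \<le> a t \<and> a t \<le> b t \<and> b t \<le> \<tau>"
    and int: "\<And>t. t \<in> {0..\<tau>} \<Longrightarrow> z integrable_on {a t..b t}"
    and z: "\<And>s. s \<in> {0..\<tau>} \<Longrightarrow> l1 (z s) \<le> M + D * f s"
    and f: "\<And>t. t \<in> {0..\<tau>} \<Longrightarrow> f t \<le> c + l1 (integral {a t..b t} z)"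
    and t: "t \<in> {0..\<tau>}"
  shows "f t \<le> 2 * (c + M * \<tau>)"
proof -
  define S where "S = Sup (f ` {0..\<tau>})"
  have le_S: "f s \<le> S" if "s \<in> {0..\<tau>}" for s
    unfolding S_def using that bdd by (intro cSup_upper imageI bdd_aboveI2 [where M = R])
  have "0 \<le> S" using le_S [OF t] nonneg [OF t] by linarith
  have "f s \<le> c + M * \<tau> + S / 2" if s: "s \<in> {0..\<tau>}" for s
  proof -
    have "l1 (integral {a s..b s} z) \<le> (M + D * S) * (b s - a s)"
    proof (rule l1_integral_le)
      show "l1 (z v) \<le> M + D * S" if "v \<in> {a s..b s}" for v
      proof -
        have v: "v \<in> {0..\<tau>}" using that ab [OF s] by auto
        show ?thesis
          using z [OF v] mult_left_mono [OF le_S [OF v] \<open>0 \<le> D\<close>] by linarith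
      qed
    qed (use int [OF s] ab [OF s] in auto)
    also have "\<dots> \<le> (M + D * S) * \<tau>"
      using ab [OF s] \<open>0 \<le> S\<close> assms(1,3) by (intro mult_left_mono) auto
    also have "\<dots> = M * \<tau> + D * \<tau> * S" by (simp add: algebra_simps)
    also have "\<dots> \<le> M * \<tau> + 1/2 * S"
      using mult_right_mono [OF assms(2) \<open>0 \<le> S\<close>] by linarith
    finally show ?thesis using f [OF s] by linarith
  qed
  then have "S \<le> c + M * \<tau> + S / 2"
    unfolding S_def using t by (intro cSup_least) auto
  then have "S \<le> 2 * (c + M * \<tau>)" by (simp add: field_simps)
  then show ?thesis using le_S [OF t] by (rule order_trans [rotated])
qed

lemma l1_integral_equation_le:
  fixes Z z :: "real \<Rightarrow> real^'n"
  assumes "0 \<le> D" "D * \<tau> \<le> 1/2" "0 \<le> M"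
    and int: "z integrable_on {0..\<tau>}"
    and Z: "\<And>t. t \<in> {0..\<tau>} \<Longrightarrow> Z t = c + integral {0..t} z"
    and z: "\<And>s. s \<in> {0..\<tau>} \<Longrightarrow> l1 (z s) \<le> M + D * l1 (Z s)"
    and t: "t \<in> {0..\<tau>}"
  shows "l1 (Z t) \<le> 2 * (l1 c + M * \<tau>)"
proof -
  \<comment> \<open>Absorption subtracts half of a supremum, so the supremum must first be known to
    be finite. Continuity of the indefinite integral on a compact interval provides this.\<close>
  have "continuous_on {0..\<tau>} (\<lambda>t. l1 (c + integral {0..t} z))"
    by (intro continuous_intros indefinite_integral_continuous_1 int)
  then have "bounded ((\<lambda>t. l1 (c + integral {0..t} z)) ` {0..\<tau>})"
    by (intro compact_imp_bounded compact_continuous_image) auto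
  then have "\<exists>R. \<forall>t\<in>{0..\<tau>}. l1 (c + integral {0..t} z) \<le> R"
    by (simp add: bounded_iff)
  then obtain R where R: "\<And>t. t \<in> {0..\<tau>} \<Longrightarrow> l1 (c + integral {0..t} z) \<le> R"
    by blast
  show ?thesis
  proof (rule half_absorption [OF assms(1-3), where f = "\<lambda>t. l1 (Z t)" and z = z and R = R
        and a = "\<lambda>_. 0" and b = "\<lambda>t. t"])
    show "l1 (Z t) \<le> R" if "t \<in> {0..\<tau>}" for t
      using R [OF that] Z [OF that] by simp
    show "z integrable_on {0..t}" if "t \<in> {0..\<tau>}" for t
      using integrable_on_initial_segment [OF int that] .
    show "l1 (Z t) \<le> l1 c + l1 (integral {0..t} z)" if "t \<in> {0..\<tau>}" for t
      using Z [OF that] l1_triangle by simp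
  qed (use z t in auto)
qed

text \<open>Subtracting the equations for two parameters cancels \<open>c\<close> and
  \<open>b\<close>; the linear term is absorbed, and an error of size E (\<bar>u\<bar> +
  \<bar>v\<bar>) remains, which gives the Cauchy property. The limit then solves the exact linear
  equation, so no separate existence theorem for it is called on. Both variational equations are
  instances: the first has \<open>c\<close> = e_i and \<open>b\<close> = 0, the second has
  \<open>c\<close> = 0 and a quadratic term in D_i Y, D_k Y as \<open>b\<close>.\<close>

lemma integral_equation_limit:
  fixes Q q :: "real \<Rightarrow> real \<Rightarrow> real^'n" and A :: "real \<Rightarrow> real^'n \<Rightarrow> real^'n"
  assumes "0 < r" "0 \<le> \<tau>" "0 \<le> D" "D * \<tau> \<le> 1/2" "0 \<le> E"
    and A_lin: "\<And>s. s \<in> {0..\<tau>} \<Longrightarrow> linear (A s)"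
    and A_le: "\<And>s v. s \<in> {0..\<tau>} \<Longrightarrow> l1 (A s v) \<le> D * l1 v"
    and q_int: "\<And>u. 0 < \<bar>u\<bar> \<Longrightarrow> \<bar>u\<bar> < r \<Longrightarrow> q u integrable_on {0..\<tau>}"
    and Q_eq: "\<And>u t. 0 < \<bar>u\<bar> \<Longrightarrow> \<bar>u\<bar> < r \<Longrightarrow> t \<in> {0..\<tau>} \<Longrightarrow> Q u t = c + integral {0..t} (q u)"
    and approx: "\<And>u s. 0 < \<bar>u\<bar> \<Longrightarrow> \<bar>u\<bar> < r \<Longrightarrow> s \<in> {0..\<tau>} \<Longrightarrow>
      l1 (q u s - (A s (Q u s) + b s)) \<le> E * \<bar>u\<bar>"
    and b: "\<And>s. s \<in> {0..\<tau>} \<Longrightarrow> l1 (b s) \<le> M"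
  obtains L where
    "\<And>u t. 0 < \<bar>u\<bar> \<Longrightarrow> \<bar>u\<bar> < r \<Longrightarrow> t \<in> {0..\<tau>} \<Longrightarrow> l1 (Q u t - L t) \<le> 2 * E * \<tau> * \<bar>u\<bar>"
    "(\<lambda>s. A s (L s) + b s) integrable_on {0..\<tau>}"
    "\<And>t. t \<in> {0..\<tau>} \<Longrightarrow> L t = c + integral {0..t} (\<lambda>s. A s (L s) + b s)"
    "\<And>t. t \<in> {0..\<tau>} \<Longrightarrow> l1 (L t) \<le> 2 * (l1 c + M * \<tau>)"
proof -
  have cauchy: "l1 (Q u t - Q v t) \<le> 2 * E * \<tau> * (\<bar>u\<bar> + \<bar>v\<bar>)"
    if u: "0 < \<bar>u\<bar>" "\<bar>u\<bar> < r" and v: "0 < \<bar>v\<bar>" "\<bar>v\<bar> < r" and t: "t \<in> {0..\<tau>}" for u v t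
  proof -
    have "l1 (Q u t - Q v t) \<le> 2 * (l1 (0 :: real^'n) + E * (\<bar>u\<bar> + \<bar>v\<bar>) * \<tau>)"
    proof (rule l1_integral_equation_le [OF \<open>0 \<le> D\<close> \<open>D * \<tau> \<le> 1/2\<close>, where z = "\<lambda>s. q u s - q v s"])
      show "(\<lambda>s. q u s - q v s) integrable_on {0..\<tau>}"
        by (intro integrable_diff q_int u v)
      show "Q u t - Q v t = 0 + integral {0..t} (\<lambda>s. q u s - q v s)" if "t \<in> {0..\<tau>}" for t
        unfolding Q_eq [OF u that] Q_eq [OF v that]
        by (simp add: integral_diff integrable_on_initial_segment [OF q_int [OF u] that]
            integrable_on_initial_segment [OF q_int [OF v] that])
      show "l1 (q u s - q v s) \<le> E * (\<bar>u\<bar> + \<bar>v\<bar>) + D * l1 (Q u s - Q v s)" if s: "s \<in> {0..\<tau>}" for s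
      proof -
        have "q u s - q v s = (q u s - (A s (Q u s) + b s)) - (q v s - (A s (Q v s) + b s))
            + A s (Q u s - Q v s)"
          by (simp add: linear_diff [OF A_lin [OF s]])
        also have "l1 \<dots> \<le> (E * \<bar>u\<bar> + E * \<bar>v\<bar>) + D * l1 (Q u s - Q v s)"
          by (intro l1_add_le l1_diff_le approx u v s A_le)
        finally show ?thesis by (simp add: algebra_simps)
      qed
    qed (use t \<open>0 \<le> E\<close> in auto)
    then show ?thesis by (simp add: algebra_simps)
  qed
  \<comment> \<open>The shift by 2 keeps even \<open>u 0\<close> strictly below \<open>r\<close>;
    with n + 1 the first term would equal \<open>r\<close>.\<close>
  define u where "u n = r / real (n + 2)" for n
  have u: "0 < \<bar>u n\<bar>" "\<bar>u n\<bar> < r" for n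
    using \<open>0 < r\<close> by (auto simp: u_def field_simps add_pos_nonneg)
  have u_lim: "(\<lambda>n. \<bar>u n\<bar>) \<longlonglongrightarrow> 0"
  proof -
    have "(\<lambda>n. r / real (n + 2)) \<longlonglongrightarrow> 0"
      using LIMSEQ_ignore_initial_segment [OF lim_const_over_n [of r], of 2] by simp
    then show ?thesis unfolding u_def by (rule tendsto_rabs_zero)
  qed
  have "convergent (\<lambda>n. Q (u n) t)" if t: "t \<in> {0..\<tau>}" for t
  proof (rule Cauchy_convergent, rule metric_CauchyI)
    fix e :: real assume "0 < e"
    have "(\<lambda>n. 4 * E * \<tau> * \<bar>u n\<bar>) \<longlonglongrightarrow> 4 * E * \<tau> * 0"
      by (intro tendsto_intros u_lim)
    with \<open>0 < e\<close> have "\<forall>\<^sub>F n in sequentially. 4 * E * \<tau> * \<bar>u n\<bar> < e"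
      by (intro order_tendstoD) auto
    then obtain N where N: "\<And>n. n \<ge> N \<Longrightarrow> 4 * E * \<tau> * \<bar>u n\<bar> < e"
      by (auto simp: eventually_sequentially)
    have "dist (Q (u m) t) (Q (u n) t) < e" if "m \<ge> N" "n \<ge> N" for m n
    proof -
      have "dist (Q (u m) t) (Q (u n) t) \<le> 2 * E * \<tau> * (\<bar>u m\<bar> + \<bar>u n\<bar>)"
        unfolding dist_norm by (rule order_trans [OF norm_le_l1 cauchy [OF u u t]])
      then show ?thesis using N [OF that(1)] N [OF that(2)] by (simp add: algebra_simps)
    qed
    then show "\<exists>N. \<forall>m\<ge>N. \<forall>n\<ge>N. dist (Q (u m) t) (Q (u n) t) < e" by blast
  qed
  then have L_lim: "(\<lambda>n. Q (u n) t) \<longlonglongrightarrow> lim (\<lambda>n. Q (u n) t)" if "t \<in> {0..\<tau>}" for t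
    using that by (simp add: convergent_LIMSEQ_iff)
  define L where "L t = lim (\<lambda>n. Q (u n) t)" for t
  have L: "l1 (Q v t - L t) \<le> 2 * E * \<tau> * \<bar>v\<bar>"
    if v: "0 < \<bar>v\<bar>" "\<bar>v\<bar> < r" and t: "t \<in> {0..\<tau>}" for v t
  proof (rule LIMSEQ_le)
    show "(\<lambda>n. l1 (Q v t - Q (u n) t)) \<longlonglongrightarrow> l1 (Q v t - L t)"
      unfolding l1_def L_def by (intro tendsto_intros L_lim t)
    show "(\<lambda>n. 2 * E * \<tau> * (\<bar>v\<bar> + \<bar>u n\<bar>)) \<longlonglongrightarrow> 2 * E * \<tau> * \<bar>v\<bar>"
      using tendsto_mult_left [OF tendsto_add [OF tendsto_const u_lim], of "2 * E * \<tau>" "\<bar>v\<bar>"]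
      by simp
    show "\<exists>N. \<forall>n\<ge>N. l1 (Q v t - Q (u n) t) \<le> 2 * E * \<tau> * (\<bar>v\<bar> + \<bar>u n\<bar>)"
      using cauchy [OF v u t] by blast
  qed
  \<comment> \<open>Replacing \<open>Q\<close> by its limit inside \<open>A s\<close> costs at most
    \<open>D\<close> times the rate 2 E \<tau> just proved.\<close>
  define E' where "E' = E + D * (2 * E * \<tau>)"
  have qL: "l1 (q v s - (A s (L s) + b s)) \<le> E' * \<bar>v\<bar>"
    if v: "0 < \<bar>v\<bar>" "\<bar>v\<bar> < r" and s: "s \<in> {0..\<tau>}" for v s
  proof -
    have "q v s - (A s (L s) + b s) = (q v s - (A s (Q v s) + b s)) + A s (Q v s - L s)"
      by (simp add: linear_diff [OF A_lin [OF s]])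
    also have "l1 \<dots> \<le> E * \<bar>v\<bar> + D * (2 * E * \<tau> * \<bar>v\<bar>)"
      by (intro l1_add_le approx v s order_trans [OF A_le] mult_left_mono L \<open>0 \<le> D\<close>)
    finally show ?thesis by (simp add: algebra_simps E'_def)
  qed
  have E'_lim: "(\<lambda>n. E' * \<bar>u n\<bar> * K) \<longlonglongrightarrow> 0" for K
    using tendsto_mult_left [OF u_lim, of "E' * K"] by (simp add: mult_ac)
  \<comment> \<open>The integrand of the limit equation is a uniform limit of the integrable
    \<open>q (u n)\<close>; this is how integrability is obtained without any regularity of
    \<open>A\<close> or \<open>b\<close> in s.\<close>
  have int: "(\<lambda>s. A s (L s) + b s) integrable_on {0..\<tau>}"
  proof -
    have "\<exists>g. (\<forall>x\<in>cbox 0 \<tau>. norm (A x (L x) + b x - g x) \<le> e) \<and> g integrable_on cbox 0 \<tau>"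
      if "0 < e" for e
    proof -
      have "\<forall>\<^sub>F n in sequentially. E' * \<bar>u n\<bar> * 1 < e"
        using \<open>0 < e\<close> by (intro order_tendstoD [OF E'_lim]) auto
      then obtain n where n: "E' * \<bar>u n\<bar> < e"
        by (auto simp: eventually_sequentially)
      show ?thesis
      proof (intro exI [of _ "q (u n)"] conjI ballI)
        show "norm (A x (L x) + b x - q (u n) x) \<le> e" if "x \<in> cbox 0 \<tau>" for x
        proof -
          have "norm (q (u n) x - (A x (L x) + b x)) \<le> E' * \<bar>u n\<bar>"
            using that by (intro order_trans [OF norm_le_l1 qL [OF u]]) auto
          with n show ?thesis by (simp add: norm_minus_commute)
        qed
        show "q (u n) integrable_on cbox 0 \<tau>" using q_int [OF u] by simp
      qed
    qed
    then show ?thesis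
      using integrable_uniform_limit [of 0 \<tau> "\<lambda>s. A s (L s) + b s"] by simp
  qed
  have eq: "L t = c + integral {0..t} (\<lambda>s. A s (L s) + b s)" if t: "t \<in> {0..\<tau>}" for t
  proof -
    have "(\<lambda>n. Q (u n) t) \<longlonglongrightarrow> c + integral {0..t} (\<lambda>s. A s (L s) + b s)"
    proof (rule LIM_zero_cancel, rule Lim_null_comparison [OF _ E'_lim [of t]], rule always_eventually,
        rule allI)
      fix n
      have "Q (u n) t - (c + integral {0..t} (\<lambda>s. A s (L s) + b s))
          = integral {0..t} (\<lambda>s. q (u n) s - (A s (L s) + b s))"
        by (subst integral_diff) (simp_all add: integrable_on_initial_segment [OF q_int [OF u] t]
            integrable_on_initial_segment [OF int t] Q_eq [OF u t])
      also have "l1 \<dots> \<le> E' * \<bar>u n\<bar> * (t - 0)"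
        using t by (intro l1_integral_le integrable_diff integrable_on_initial_segment [OF q_int [OF u] t]
            integrable_on_initial_segment [OF int t] qL [OF u]) auto
      finally show "norm (Q (u n) t - (c + integral {0..t} (\<lambda>s. A s (L s) + b s))) \<le> E' * \<bar>u n\<bar> * t"
        using norm_le_l1 order_trans by fastforce
    qed
    with L_lim [OF t] show ?thesis unfolding L_def using LIMSEQ_unique by blast
  qed
  have "0 \<le> M" using b [of 0] \<open>0 \<le> \<tau>\<close> l1_nonneg [of "b 0"] by (auto simp del: l1_nonneg)
  have "l1 (L t) \<le> 2 * (l1 c + M * \<tau>)" if t: "t \<in> {0..\<tau>}" for t
  proof (rule l1_integral_equation_le [OF \<open>0 \<le> D\<close> \<open>D * \<tau> \<le> 1/2\<close> \<open>0 \<le> M\<close> int eq _ t])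
    show "l1 (A s (L s) + b s) \<le> M + D * l1 (L s)" if "s \<in> {0..\<tau>}" for s
      using l1_add_le [OF A_le [OF that] b [OF that]] by (simp add: add.commute)
  qed
  with L int eq show thesis using that by blast
qed

section \<open>Mean value and Taylor estimates from partial derivatives\<close>

lemma axis_step_le:
  fixes g :: "real^'n \<Rightarrow> real"
  assumes "convex U"
    and deriv: "\<And>x k. x \<in> U \<Longrightarrow> ((\<lambda>u. g (x + u *\<^sub>R axis k 1)) has_real_derivative g' k x) (at 0)"
    and bound: "\<And>x k. x \<in> U \<Longrightarrow> \<bar>g' k x\<bar> \<le> B k"
    and a: "a \<in> U" "a + c *\<^sub>R axis k 1 \<in> U"
  shows "\<bar>g (a + c *\<^sub>R axis k 1) - g a\<bar> \<le> B k * \<bar>c\<bar>"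
proof -
  let ?f = "\<lambda>v. g (a + v *\<^sub>R axis k 1)"
  have in_U: "a + v *\<^sub>R axis k 1 \<in> U" if v: "v \<in> closed_segment 0 c" for v
  proof -
    obtain s where s: "0 \<le> s" "s \<le> 1" "v = s * c"
      using v by (auto simp: in_segment)
    have "a + v *\<^sub>R axis k 1 = (1 - s) *\<^sub>R a + s *\<^sub>R (a + c *\<^sub>R axis k 1)"
      by (simp add: s algebra_simps)
    also have "\<dots> \<in> U"
      using \<open>convex U\<close> a s by (intro convexD) auto
    finally show ?thesis .
  qed
  have "norm (?f c - ?f 0) \<le> B k * norm (c - 0)"
  proof (rule field_differentiable_bound [OF convex_closed_segment])
    fix v assume "v \<in> closed_segment 0 c"
    note v = in_U [OF this]
    have "(?f has_real_derivative g' k (a + v *\<^sub>R axis k 1)) (at (0 + v))"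
      unfolding DERIV_shift using deriv [OF v, of k] by (simp add: algebra_simps)
    then show "(?f has_real_derivative g' k (a + v *\<^sub>R axis k 1)) (at v within closed_segment 0 c)"
      by (simp add: has_field_derivative_at_within)
    show "norm (g' k (a + v *\<^sub>R axis k 1)) \<le> B k"
      using bound [OF v] by simp
  qed auto
  then show ?thesis by simp
qed

text \<open>The coordinates of \<open>a\<close> are exchanged for those of \<open>b\<close> one at a
  time. An intermediate point differs from \<open>a\<close> componentwise by no more than
  \<open>b\<close> does, so it stays in the ball; in a general convex set such a staircase could
  leave.\<close>

lemma axis_lipschitz_on_ball:
  fixes g :: "real^'n \<Rightarrow> real"
  assumes "convex U"
    and deriv: "\<And>x k. x \<in> U \<Longrightarrow> ((\<lambda>u. g (x + u *\<^sub>R axis k 1)) has_real_derivative g' k x) (at 0)"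
    and bound: "\<And>x k. x \<in> U \<Longrightarrow> \<bar>g' k x\<bar> \<le> B k"
    and ball: "ball a r \<subseteq> U" "b \<in> ball a r"
  shows "\<bar>g b - g a\<bar> \<le> (\<Sum>k\<in>UNIV. B k * \<bar>b $ k - a $ k\<bar>)"
proof -
  define z where "z S = (\<chi> i. if i \<in> S then b $ i else a $ i)" for S
  have z_U: "z S \<in> U" for S
  proof -
    have "norm (z S - a) \<le> norm (b - a)"
      by (rule norm_le_componentwise_cart) (simp add: z_def)
    with ball show ?thesis by (auto simp: dist_norm norm_minus_commute)
  qed
  have "\<bar>g (z S) - g a\<bar> \<le> (\<Sum>k\<in>S. B k * \<bar>b $ k - a $ k\<bar>)" if "finite S" for S
    using that
  proof induction
    case empty
    have "z {} = a" by (simp add: z_def vec_eq_iff)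
    then show ?case by simp
  next
    case (insert k S)
    have z_insert: "z (insert k S) = z S + (b $ k - a $ k) *\<^sub>R axis k 1"
      using insert.hyps by (auto simp: z_def vec_eq_iff axis_def)
    have "\<bar>g (z (insert k S)) - g (z S)\<bar> \<le> B k * \<bar>b $ k - a $ k\<bar>"
      unfolding z_insert
      by (rule axis_step_le [OF \<open>convex U\<close> deriv bound])
        (use z_U [of S] z_U [of "insert k S"] in \<open>auto simp: z_insert\<close>)
    with insert show ?case by simp
  qed
  from this [of UNIV] have "\<bar>g (z UNIV) - g a\<bar> \<le> (\<Sum>k\<in>UNIV. B k * \<bar>b $ k - a $ k\<bar>)" by simp
  moreover have "z UNIV = b" by (simp add: z_def vec_eq_iff)
  ultimately show ?thesis by simp
qed

(* Only the existence and boundedness of the partial derivatives is assumed, so g need not be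
   differentiable; axis-parallel steps give the bound near each point, and it is then propagated
   along the segment from a to b. *)
lemma axis_lipschitz:
  fixes g :: "real^'n \<Rightarrow> real"
  assumes "convex U" "open U"
    and deriv: "\<And>x k. x \<in> U \<Longrightarrow> ((\<lambda>u. g (x + u *\<^sub>R axis k 1)) has_real_derivative g' k x) (at 0)"
    and bound: "\<And>x k. x \<in> U \<Longrightarrow> \<bar>g' k x\<bar> \<le> B k"
    and "a \<in> U" "b \<in> U"
  shows "\<bar>g b - g a\<bar> \<le> (\<Sum>k\<in>UNIV. B k * \<bar>b $ k - a $ k\<bar>)"
proof -
  define c where "c = (\<Sum>k\<in>UNIV. B k * \<bar>b $ k - a $ k\<bar>)"
  define l where "l s = a + s *\<^sub>R (b - a)" for s :: real
  have l_U: "l s \<in> U" if "0 \<le> s" "s \<le> 1" for s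
  proof -
    have "l s = (1 - s) *\<^sub>R a + s *\<^sub>R b" by (simp add: l_def algebra_simps)
    also have "\<dots> \<in> U" using assms(1,5,6) that by (intro convexD) auto
    finally show ?thesis .
  qed
  have "(0::real) \<le> 1" by simp
  \<comment> \<open>Bisection glues the local estimates: the bound c (s' - s) is additive over
    adjacent intervals, and every s has a neighbourhood on which it holds.\<close>
  then have "0 \<le> (0::real) \<longrightarrow> (1::real) \<le> 1 \<longrightarrow> \<bar>g (l 1) - g (l 0)\<bar> \<le> c * (1 - 0)"
  proof (induction rule: Bolzano [where P = "\<lambda>s s'. 0 \<le> s \<longrightarrow> s' \<le> 1 \<longrightarrow> \<bar>g (l s') - g (l s)\<bar> \<le> c * (s' - s)"])
    case (trans s1 s2 s3)
    then show ?case by (auto simp: algebra_simps)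
  next
    case (local s)
    obtain r where r: "0 < r" "ball (l s) r \<subseteq> U"
      using \<open>open U\<close> l_U [OF local] openE by blast
    have near: "\<bar>g (l s') - g (l s)\<bar> \<le> c * \<bar>s' - s\<bar>" if s': "\<bar>s' - s\<bar> * norm (b - a) < r" for s'
    proof -
      have diff: "l s' - l s = (s' - s) *\<^sub>R (b - a)" by (simp add: l_def algebra_simps)
      have "dist (l s) (l s') < r"
        using s' by (simp add: dist_commute dist_norm diff)
      then have "\<bar>g (l s') - g (l s)\<bar> \<le> (\<Sum>k\<in>UNIV. B k * \<bar>l s' $ k - l s $ k\<bar>)"
        by (intro axis_lipschitz_on_ball [OF \<open>convex U\<close> deriv bound r(2)]) auto
      also have "\<dots> = (\<Sum>k\<in>UNIV. B k * \<bar>b $ k - a $ k\<bar> * \<bar>s' - s\<bar>)"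
        by (intro sum.cong refl) (simp add: diff abs_mult flip: vector_minus_component)
      finally show ?thesis by (simp add: c_def sum_distrib_right)
    qed
    \<comment> \<open>The summand 1 avoids division by zero when \<open>a\<close> =
      \<open>b\<close>.\<close>
    define d where "d = r / (norm (b - a) + 1)"
    have d: "\<bar>x\<bar> * norm (b - a) < r" if "\<bar>x\<bar> < d" for x
    proof -
      have "\<bar>x\<bar> * (norm (b - a) + 1) < r"
        using that by (simp add: d_def pos_less_divide_eq add_nonneg_pos)
      then show ?thesis by (simp add: algebra_simps)
    qed
    show ?case
    proof (intro exI [of _ d] conjI allI impI)
      show "0 < d" using r(1) by (simp add: d_def add_nonneg_pos)
      fix s1 s2 :: real
      assume s: "s1 \<le> s \<and> s \<le> s2 \<and> s2 - s1 < d"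
      have "\<bar>g (l s1) - g (l s)\<bar> \<le> c * (s - s1)" "\<bar>g (l s2) - g (l s)\<bar> \<le> c * (s2 - s)"
        using near [of s1] near [of s2] d [of "s1 - s"] d [of "s2 - s"] s by auto
      then show "\<bar>g (l s2) - g (l s1)\<bar> \<le> c * (s2 - s1)"
        by (auto simp: algebra_simps)
    qed
  qed
  then show ?thesis by (simp add: l_def c_def)
qed

text \<open>Pairing with the sign vector of the increment leaves a single scalar function whose
  partial derivatives are bounded by the l1 norms of the columns.\<close>

lemma axis_lipschitz_vec:
  fixes G :: "real^'n \<Rightarrow> real^'m"
  assumes "convex U" "open U"
    and deriv: "\<And>x k. x \<in> U \<Longrightarrow> ((\<lambda>u. G (x + u *\<^sub>R axis k 1)) has_vector_derivative G' k x) (at 0)"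
    and bound: "\<And>x k. x \<in> U \<Longrightarrow> l1 (G' k x) \<le> B k"
    and "a \<in> U" "b \<in> U"
  shows "l1 (G b - G a) \<le> (\<Sum>k\<in>UNIV. B k * \<bar>b $ k - a $ k\<bar>)"
proof -
  obtain w where w: "\<And>k. \<bar>w $ k\<bar> \<le> 1" "w \<bullet> (G b - G a) = l1 (G b - G a)"
    using l1_eq_inner by blast
  have "\<bar>w \<bullet> G b - w \<bullet> G a\<bar> \<le> (\<Sum>k\<in>UNIV. B k * \<bar>b $ k - a $ k\<bar>)"
  proof (rule axis_lipschitz [OF assms(1,2) _ _ assms(5,6)])
    fix x k assume "x \<in> U"
    show "((\<lambda>u. w \<bullet> G (x + u *\<^sub>R axis k 1)) has_real_derivative w \<bullet> G' k x) (at 0)"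
      using bounded_linear.has_vector_derivative [OF bounded_linear_inner_right deriv [OF \<open>x \<in> U\<close>, of k], of w]
      by (simp add: has_real_derivative_iff_has_vector_derivative)
    show "\<bar>w \<bullet> G' k x\<bar> \<le> B k"
      using inner_le_l1 [OF w(1)] bound [OF \<open>x \<in> U\<close>] order_trans by blast
  qed
  with w(2) show ?thesis by (simp add: inner_diff_right)
qed

text \<open>Subtracting the linear part at \<open>a\<close> gives a map whose partial derivatives
  are G'(x) - G'(a), hence small near \<open>a\<close>; the mean value estimate applied to this
  remainder is quadratic. The factor CARD('n) is harmless, as the constant only enters convergence
  rates.\<close>

lemma axis_taylor_vec:
  fixes G :: "real^'n \<Rightarrow> real^'m"
  assumes "convex U" "open U"
    and deriv: "\<And>x k. x \<in> U \<Longrightarrow> ((\<lambda>u. G (x + u *\<^sub>R axis k 1)) has_vector_derivative G' k x) (at 0)"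
    and lip: "\<And>x y k. x \<in> U \<Longrightarrow> y \<in> U \<Longrightarrow> l1 (G' k y - G' k x) \<le> D * infnorm (y - x)"
    and a: "a \<in> U" and b: "b \<in> U"
  shows "l1 (G b - G a - (\<Sum>k\<in>UNIV. (b - a) $ k *\<^sub>R G' k a))
    \<le> 2 * D * real CARD('n) * (infnorm (b - a))\<^sup>2"
proof (cases "a = b")
  case True
  then show ?thesis by (simp add: infnorm_0)
next
  case False
  define N where "N = infnorm (b - a)"
  have "0 < N" using False by (simp add: N_def infnorm_pos_lt)
  have "0 \<le> D"
    using order_trans [OF l1_nonneg lip [OF a b]] \<open>0 < N\<close> by (simp add: N_def zero_le_mult_iff)
  \<comment> \<open>The point \<open>b\<close> lies at max distance exactly \<open>N\<close> from
    \<open>a\<close>; the radius 2 N lets an open box contain it, at the price of the factor 2 in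
    the bound.\<close>
  define W where "W = U \<inter> {y. infnorm (y - a) < 2 * N}"
  have "open {y. infnorm (y - a) < 2 * N}"
    by (intro open_Collect_less continuous_intros)
  then have "open W" unfolding W_def using \<open>open U\<close> by (rule open_Int [rotated])
  have "convex {y. infnorm (y - a) < 2 * N}"
  proof (rule convexI)
    fix x y and s t :: real
    assume x: "x \<in> {y. infnorm (y - a) < 2 * N}" and y: "y \<in> {y. infnorm (y - a) < 2 * N}"
      and st: "0 \<le> s" "0 \<le> t" "s + t = 1"
    have eq: "s *\<^sub>R x + t *\<^sub>R y - a = s *\<^sub>R (x - a) + t *\<^sub>R (y - a)"
      using st(3) by (simp add: algebra_simps flip: scaleR_left_distrib)
    have "infnorm (s *\<^sub>R x + t *\<^sub>R y - a) \<le> s * infnorm (x - a) + t * infnorm (y - a)"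
      unfolding eq using infnorm_triangle [of "s *\<^sub>R (x - a)" "t *\<^sub>R (y - a)"] st by simp
    also have "\<dots> < 2 * N"
      using x y st by (intro convex_bound_lt) auto
    finally show "s *\<^sub>R x + t *\<^sub>R y \<in> {y. infnorm (y - a) < 2 * N}" by simp
  qed
  then have "convex W" unfolding W_def using \<open>convex U\<close> by (rule convex_Int [rotated])
  define H where "H y = G y - (\<Sum>k\<in>UNIV. (y - a) $ k *\<^sub>R G' k a)" for y
  have "l1 (H b - H a) \<le> (\<Sum>k\<in>UNIV. D * (2 * N) * \<bar>b $ k - a $ k\<bar>)"
  proof (rule axis_lipschitz_vec [OF \<open>convex W\<close> \<open>open W\<close>])
    fix x k assume "x \<in> W"
    then have x: "x \<in> U" "infnorm (x - a) \<le> 2 * N" by (auto simp: W_def)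
    have H_eq: "H (x + u *\<^sub>R axis k 1) = G (x + u *\<^sub>R axis k 1) - (\<Sum>k\<in>UNIV. (x - a) $ k *\<^sub>R G' k a) - u *\<^sub>R G' k a" for u
    proof -
      have "(\<Sum>l\<in>UNIV. (u *\<^sub>R axis k 1 :: real^'n) $ l *\<^sub>R G' l a) = (\<Sum>l\<in>UNIV. if l = k then u *\<^sub>R G' k a else 0)"
        by (intro sum.cong) (auto simp: axis_def)
      then show ?thesis
        by (simp add: H_def algebra_simps sum.distrib sum_subtractf)
    qed
    show "((\<lambda>u. H (x + u *\<^sub>R axis k 1)) has_vector_derivative G' k x - G' k a) (at 0)"
      unfolding H_eq by (auto intro!: derivative_eq_intros deriv x)
    show "l1 (G' k x - G' k a) \<le> D * (2 * N)"
      using lip [OF a x(1)] mult_left_mono [OF x(2) \<open>0 \<le> D\<close>] order_trans by blast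
  qed (use a b \<open>0 < N\<close> in \<open>auto simp: W_def N_def infnorm_0\<close>)
  also have "\<dots> \<le> (\<Sum>k\<in>(UNIV :: 'n set). D * (2 * N) * N)"
    using \<open>0 \<le> D\<close> \<open>0 < N\<close> component_le_infnorm_cart [of "b - a"]
    by (intro sum_mono mult_left_mono) (auto simp: N_def)
  finally have "l1 (H b - H a) \<le> (\<Sum>k\<in>(UNIV :: 'n set). D * (2 * N) * N)" .
  moreover have "H b - H a = G b - G a - (\<Sum>k\<in>UNIV. (b - a) $ k *\<^sub>R G' k a)"
    by (simp add: H_def)
  ultimately show ?thesis by (simp add: N_def power2_eq_square mult_ac)
qed

section \<open>Iterated partial derivatives and the multi-index norms\<close>

lemma has_iterated_partial_unique:
  "has_iterated_partial is f x d \<Longrightarrow> has_iterated_partial is f x d' \<Longrightarrow> d = d'"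
proof (induction "is" arbitrary: x d d')
  case (Cons i "is")
  from Cons.prems obtain g g' where
    g: "\<forall>\<^sub>F u in nhds 0. has_iterated_partial is f (x + u *\<^sub>R axis i 1) (g u)" "(g has_real_derivative d) (at 0)"
    and g': "\<forall>\<^sub>F u in nhds 0. has_iterated_partial is f (x + u *\<^sub>R axis i 1) (g' u)" "(g' has_real_derivative d') (at 0)"
    by auto
  \<comment> \<open>The filter \<open>nhds 0\<close> includes the point 0, so the two witnesses also
    agree there and have the same derivative.\<close>
  have "\<forall>\<^sub>F u in nhds 0. g u = g' u"
    using g(1) g'(1) by eventually_elim (rule Cons.IH)
  then have "(g has_real_derivative d') (at 0)"
    using g'(2) DERIV_cong_ev [of 0 0 g g' d' d'] by simp
  with g(2) show ?case by (rule DERIV_unique)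
qed simp

text \<open>The list \<open>is\<close> is itself an ordering of its multi-index, so the quantifier
  over orderings is not vacuous. Uniqueness along this one ordering determines the value of
  \<open>THE\<close>.\<close>

lemma has_iterated_partial_multi_partial:
  assumes "has_multi_partial (count_list is) f x d"
  shows "has_iterated_partial is f x (multi_partial (count_list is) f x)"
proof -
  have it: "has_iterated_partial is f x d'" if "has_multi_partial (count_list is) f x d'" for d'
    using that by (simp add: has_multi_partial_def)
  have "multi_partial (count_list is) f x = d"
    unfolding multi_partial_def
  proof (rule the_equality)
    show "d' = d" if "has_multi_partial (count_list is) f x d'" for d'
      using it [OF that] it [OF assms] by (rule has_iterated_partial_unique)
  qed (rule assms)
  with it [OF assms] show ?thesis by simp
qed

lemma sum_count_list_UNIV: "(\<Sum>k\<in>UNIV. count_list is (k :: 'n::finite)) = length is"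
  by (rule sum_count_set) auto

text \<open>Indexing by lists makes one more differentiation a \<open>Cons\<close>, while
  \<open>count_list\<close> keeps the value independent of the order.\<close>

definition Dvec :: "'n list \<Rightarrow> (real^'n \<Rightarrow> real^'n) \<Rightarrow> real^'n \<Rightarrow> real^'n" where
  "Dvec is V x = (\<chi> j. multi_partial (count_list is) (\<lambda>y. V y $ j) x)"

lemma has_iterated_partial_Dvec:
  assumes "partials_exist_upto m V M" "length is \<le> m" "x \<in> M"
  shows "has_iterated_partial is (\<lambda>y. V y $ j) x (Dvec is V x $ j)"
proof -
  obtain d where "has_multi_partial (count_list is) (\<lambda>y. V y $ j) x d"
    using assms unfolding partials_exist_upto_def by (metis sum_count_list_UNIV)
  then show ?thesis
    unfolding Dvec_def by (simp add: has_iterated_partial_multi_partial)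
qed

lemma Dvec_Nil:
  assumes "partials_exist_upto m V M" "x \<in> M"
  shows "Dvec [] V x = V x"
  using has_iterated_partial_Dvec [OF assms(1), of "[]" x] assms(2) by (simp add: vec_eq_iff)

text \<open>The inner function in an iterated partial derivative is an arbitrary witness. It
  coincides with \<open>Dvec\<close> where the latter is known to be a derivative, that is in
  \<open>M\<close>; the open set \<open>U\<close> guarantees this for all small steps along the
  axis.\<close>

lemma has_vector_derivative_Dvec:
  assumes V: "partials_exist_upto m V M" and "length is < m" "open U" "U \<subseteq> M" "x \<in> U"
  shows "((\<lambda>u. Dvec is V (x + u *\<^sub>R axis k 1)) has_vector_derivative Dvec (k # is) V x) (at 0)"
proof -
  have "((\<lambda>u. Dvec is V (x + u *\<^sub>R axis k 1) $ j) has_real_derivative Dvec (k # is) V x $ j) (at 0)" for j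
  proof -
    have "has_iterated_partial (k # is) (\<lambda>y. V y $ j) x (Dvec (k # is) V x $ j)"
      using assms by (intro has_iterated_partial_Dvec [OF V]) auto
    then obtain g where
      g: "\<forall>\<^sub>F u in nhds 0. has_iterated_partial is (\<lambda>y. V y $ j) (x + u *\<^sub>R axis k 1) (g u)"
        "(g has_real_derivative Dvec (k # is) V x $ j) (at 0)"
      by auto
    have "((\<lambda>u. x + u *\<^sub>R axis k 1) \<longlongrightarrow> x + 0 *\<^sub>R axis k 1) (nhds (0::real))"
      by (intro tendsto_intros filterlim_ident)
    then have "\<forall>\<^sub>F u in nhds (0::real). x + u *\<^sub>R axis k 1 \<in> U"
      using \<open>open U\<close> \<open>x \<in> U\<close> topological_tendstoD by fastforce
    with g(1) have "\<forall>\<^sub>F u in nhds 0. g u = Dvec is V (x + u *\<^sub>R axis k 1) $ j"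
    proof eventually_elim
      case (elim u)
      with assms have "has_iterated_partial is (\<lambda>y. V y $ j) (x + u *\<^sub>R axis k 1) (Dvec is V (x + u *\<^sub>R axis k 1) $ j)"
        by (intro has_iterated_partial_Dvec [OF V]) auto
      with elim(1) show ?case by (rule has_iterated_partial_unique)
    qed
    with g(2) show ?thesis
      by (subst (asm) DERIV_cong_ev [OF refl _ refl]) auto
  qed
  then show ?thesis
    unfolding has_vector_derivative_def has_field_derivative_def
    by (subst has_derivative_componentwise_within)
      (auto simp: Basis_vec_def inner_axis mult_commute_abs)
qed

text \<open>The share of one multi-index in \<open>Dsupn\<close>, with the sum over components moved
  inside: exactly the quantity that dominates the l1 norm of the column D^\<alpha> V.\<close>

definition supsum :: "('n \<Rightarrow> nat) \<Rightarrow> (real^'n \<Rightarrow> real^'n) \<Rightarrow> (real^'n) set \<Rightarrow> ennreal" where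
  "supsum \<alpha> V M = (\<Sum>i\<in>UNIV. SUP x\<in>M. ennreal \<bar>multi_partial \<alpha> (\<lambda>y. V y $ i) x\<bar>)"

lemma Dsupn_eq_sum_supsum: "Dsupn j V M = (\<Sum>\<alpha>\<in>{\<alpha>. (\<Sum>k\<in>UNIV. \<alpha> k) = j}. supsum \<alpha> V M)"
  unfolding Dsupn_def supsum_def by (rule sum.swap)

text \<open>Over an infinite index set the sum in \<open>Dsupn\<close> would take the default value
  0; finiteness makes it dominate its partial sums.\<close>

lemma finite_multi_indices: "finite {\<alpha> :: 'n::finite \<Rightarrow> nat. (\<Sum>k\<in>UNIV. \<alpha> k) = j}"
proof (rule finite_subset)
  show "{\<alpha> :: 'n \<Rightarrow> nat. (\<Sum>k\<in>UNIV. \<alpha> k) = j} \<subseteq> {f. \<forall>x. (x \<in> UNIV \<longrightarrow> f x \<in> {..j}) \<and> (x \<notin> UNIV \<longrightarrow> f x = 0)}"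
    by (auto intro: member_le_sum)
  show "finite {f :: 'n \<Rightarrow> nat. \<forall>x. (x \<in> UNIV \<longrightarrow> f x \<in> {..j}) \<and> (x \<notin> UNIV \<longrightarrow> f x = 0)}"
    by (rule finite_set_of_finite_funs) auto
qed

(* For fixed "is" the multi-indices of k # is are pairwise distinct. Summing over only one free
   index is what makes the multi-index norms suffice without multinomial factors. *)
lemma sum_supsum_Cons_le: "(\<Sum>k\<in>UNIV. supsum (count_list (k # is)) V M) \<le> Dsupn (Suc (length is)) V M"
proof -
  have "inj (\<lambda>k. count_list (k # is))"
  proof (rule injI)
    fix k l assume "count_list (k # is) = count_list (l # is)"
    from fun_cong [OF this, of k] show "k = l" by (auto split: if_splits)
  qed
  then have "(\<Sum>k\<in>UNIV. supsum (count_list (k # is)) V M) = (\<Sum>\<alpha>\<in>range (\<lambda>k. count_list (k # is)). supsum \<alpha> V M)"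
    by (subst sum.reindex) (auto simp: o_def)
  also have "\<dots> \<le> Dsupn (Suc (length is)) V M"
    unfolding Dsupn_eq_sum_supsum
  proof (rule sum_mono2 [OF finite_multi_indices])
    show "range (\<lambda>k. count_list (k # is)) \<subseteq> {\<alpha>. (\<Sum>k\<in>UNIV. \<alpha> k) = Suc (length is)}"
      using sum_count_list_UNIV [of "_ # is"] by auto
  qed auto
  finally show ?thesis .
qed

lemma ennreal_l1_Dvec_le:
  assumes "x \<in> M"
  shows "ennreal (l1 (Dvec is V x)) \<le> supsum (count_list is) V M"
proof -
  have "ennreal (l1 (Dvec is V x)) = (\<Sum>j\<in>UNIV. ennreal \<bar>Dvec is V x $ j\<bar>)"
    unfolding l1_def by simp
  also have "\<dots> \<le> supsum (count_list is) V M"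
    unfolding supsum_def Dvec_def using assms by (intro sum_mono) (auto intro: SUP_upper)
  finally show ?thesis .
qed

context
  fixes V :: "real^'n \<Rightarrow> real^'n" and M :: "(real^'n) set" and m :: nat
  assumes V: "partials_exist_upto m V M" and fin: "\<And>j. 1 \<le> j \<Longrightarrow> j \<le> m \<Longrightarrow> Dsupn j V M < \<infinity>"
begin

text \<open>\<open>enn2real\<close> sends \<infinity> to 0, so finiteness must be secured before any
  bound is transferred to the reals.\<close>

lemma supsum_Cons_finite:
  assumes "length is < m"
  shows "supsum (count_list (k # is)) V M < \<infinity>"
proof -
  have "supsum (count_list (k # is)) V M \<le> (\<Sum>k\<in>UNIV. supsum (count_list (k # is)) V M)"
    by (rule member_le_sum) auto
  also have "\<dots> \<le> Dsupn (Suc (length is)) V M" by (rule sum_supsum_Cons_le)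
  also have "\<dots> < \<infinity>" using fin [of "Suc (length is)"] assms by simp
  finally show ?thesis .
qed

lemma sum_real_supsum_Cons_le:
  assumes "length is < m"
  shows "(\<Sum>k\<in>UNIV. enn2real (supsum (count_list (k # is)) V M)) \<le> enn2real (Dsupn (Suc (length is)) V M)"
proof -
  have "(\<Sum>k\<in>UNIV. enn2real (supsum (count_list (k # is)) V M)) = enn2real (\<Sum>k\<in>UNIV. supsum (count_list (k # is)) V M)"
    using supsum_Cons_finite [OF assms] by (subst enn2real_sum) (auto simp: o_def)
  also have "\<dots> \<le> enn2real (Dsupn (Suc (length is)) V M)"
    using fin [of "Suc (length is)"] assms by (intro enn2real_mono sum_supsum_Cons_le) auto
  finally show ?thesis .
qed

lemma l1_Dvec_le:
  assumes "length is < m" "x \<in> M"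
  shows "l1 (Dvec (k # is) V x) \<le> enn2real (supsum (count_list (k # is)) V M)"
proof -
  have "enn2real (ennreal (l1 (Dvec (k # is) V x))) \<le> enn2real (supsum (count_list (k # is)) V M)"
    using supsum_Cons_finite [OF assms(1)] by (intro enn2real_mono ennreal_l1_Dvec_le assms) auto
  then show ?thesis by simp
qed

lemma l1_sum_Dvec_le:
  assumes "length is < m" "x \<in> M"
  shows "l1 (\<Sum>k\<in>UNIV. v $ k *\<^sub>R Dvec (k # is) V x) \<le> enn2real (Dsupn (Suc (length is)) V M) * infnorm v"
  by (rule l1_sum_scaleR_infnorm [OF l1_Dvec_le sum_real_supsum_Cons_le]) (use assms in auto)

lemma Dvec_lipschitz:
  assumes "length is < m" "open U" "convex U" "U \<subseteq> M" "a \<in> U" "b \<in> U"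
  shows "l1 (Dvec is V b - Dvec is V a) \<le> enn2real (Dsupn (Suc (length is)) V M) * infnorm (b - a)"
proof -
  let ?B = "\<lambda>k. enn2real (supsum (count_list (k # is)) V M)"
  have "l1 (Dvec is V b - Dvec is V a) \<le> (\<Sum>k\<in>UNIV. ?B k * \<bar>b $ k - a $ k\<bar>)"
    using assms
    by (intro axis_lipschitz_vec [where U = U and G' = "\<lambda>k. Dvec (k # is) V"]
        has_vector_derivative_Dvec [OF V] l1_Dvec_le) auto
  also have "\<dots> \<le> (\<Sum>k\<in>UNIV. ?B k * infnorm (b - a))"
    using component_le_infnorm_cart [of "b - a"] by (intro sum_mono mult_left_mono) auto
  also have "\<dots> \<le> enn2real (Dsupn (Suc (length is)) V M) * infnorm (b - a)"
    unfolding sum_distrib_right [symmetric]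
    by (intro mult_right_mono sum_real_supsum_Cons_le assms infnorm_pos_le)
  finally show ?thesis .
qed

lemma Dvec_taylor:
  assumes "Suc (length is) < m" "open U" "convex U" "U \<subseteq> M" "a \<in> U" "b \<in> U"
  shows "l1 (Dvec is V b - Dvec is V a - (\<Sum>k\<in>UNIV. (b - a) $ k *\<^sub>R Dvec (k # is) V a))
    \<le> 2 * enn2real (Dsupn (Suc (Suc (length is))) V M) * real CARD('n) * (infnorm (b - a))\<^sup>2"
proof (rule axis_taylor_vec [where U = U])
  show "l1 (Dvec (k # is) V y - Dvec (k # is) V x)
      \<le> enn2real (Dsupn (Suc (Suc (length is))) V M) * infnorm (y - x)"
    if "x \<in> U" "y \<in> U" for x y k
    using Dvec_lipschitz [of "k # is" U x y] assms that by simp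
qed (use assms in \<open>auto intro: has_vector_derivative_Dvec [OF V]\<close>)

end

section \<open>Enlargements of K, and the setting of the variational equations\<close>

lemma enlarge_add:
  assumes "x \<in> enlarge K r" "infnorm h \<le> s"
  shows "x + h \<in> enlarge K (r + s)"
proof -
  obtain z where z: "z \<in> K" "infnorm (x - z) < r"
    using assms(1) by (auto simp: enlarge_def Bstar_def)
  have "infnorm (x + h - z) \<le> infnorm (x - z) + infnorm h"
    using infnorm_triangle [of "x - z" h] by (simp add: algebra_simps)
  with z assms(2) show ?thesis by (force simp: enlarge_def Bstar_def)
qed

lemma enlarge_mono: "r \<le> s \<Longrightarrow> enlarge K r \<subseteq> enlarge K s"
  unfolding enlarge_def Bstar_def using order_less_le_trans by blast

lemma subset_enlarge: "0 < r \<Longrightarrow> K \<subseteq> enlarge K r"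
  by (auto simp: enlarge_def Bstar_def infnorm_0)

lemma open_enlarge: "open (enlarge K r)"
  unfolding enlarge_def Bstar_def
  by (intro open_UN ballI open_Collect_less continuous_intros)

(* F1 k and F2 k l stand for the derivatives D_k V and D_l D_k V. The Lipschitz bounds measure the
   space increment in the max norm and the values in the l1 norm. *)
locale variational_flow =
  fixes V :: "real^'n \<Rightarrow> real^'n" and F1 :: "'n \<Rightarrow> real^'n \<Rightarrow> real^'n"
    and F2 :: "'n \<Rightarrow> 'n \<Rightarrow> real^'n \<Rightarrow> real^'n"
    and U K :: "(real^'n) set" and D1 D2 D3 C \<tau> :: real
    and Y :: "real^'n \<Rightarrow> real \<Rightarrow> real^'n"
  assumes nonneg: "0 \<le> D1" "0 \<le> D2" "0 \<le> D3" "0 \<le> C" "0 \<le> \<tau>" and D1_\<tau>: "D1 * \<tau> \<le> 1/2"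
    and V_taylor: "\<And>a b. a \<in> U \<Longrightarrow> b \<in> U \<Longrightarrow>
      l1 (V b - V a - (\<Sum>k\<in>UNIV. (b - a) $ k *\<^sub>R F1 k a)) \<le> C * (infnorm (b - a))\<^sup>2"
    and F1_le: "\<And>a v. a \<in> U \<Longrightarrow> l1 (\<Sum>k\<in>UNIV. v $ k *\<^sub>R F1 k a) \<le> D1 * infnorm v"
    and F1_lip: "\<And>k a b. a \<in> U \<Longrightarrow> b \<in> U \<Longrightarrow> l1 (F1 k b - F1 k a) \<le> D2 * infnorm (b - a)"
    and F1_taylor: "\<And>k a b. a \<in> U \<Longrightarrow> b \<in> U \<Longrightarrow>
      l1 (F1 k b - F1 k a - (\<Sum>l\<in>UNIV. (b - a) $ l *\<^sub>R F2 k l a)) \<le> C * (infnorm (b - a))\<^sup>2"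
    and F2_le: "\<And>k a v. a \<in> U \<Longrightarrow> l1 (\<Sum>l\<in>UNIV. v $ l *\<^sub>R F2 k l a) \<le> D2 * infnorm v"
    and F2_lip: "\<And>k l a b. a \<in> U \<Longrightarrow> b \<in> U \<Longrightarrow> l1 (F2 k l b - F2 k l a) \<le> D3 * infnorm (b - a)"
    and Y_in: "\<And>x t. x \<in> enlarge K 3 \<Longrightarrow> t \<in> {0..\<tau>} \<Longrightarrow> Y x t \<in> U"
    and Y_int: "\<And>x. x \<in> enlarge K 3 \<Longrightarrow> (\<lambda>s. V (Y x s)) integrable_on {0..\<tau>}"
    and Y_eq: "\<And>x x' t. x \<in> enlarge K 3 \<Longrightarrow> x' \<in> enlarge K 3 \<Longrightarrow> t \<in> {0..\<tau>} \<Longrightarrow>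
      Y x' t - Y x t = (x' - x) + integral {0..t} (\<lambda>s. V (Y x' s) - V (Y x s))"
    and Y_lip: "\<And>x x' t. x \<in> enlarge K 3 \<Longrightarrow> x' \<in> enlarge K 3 \<Longrightarrow> t \<in> {0..\<tau>} \<Longrightarrow>
      infnorm (Y x' t - Y x t) \<le> 2 * infnorm (x' - x)"
begin

text \<open>DV(a) v, kept as a sum over partial derivatives because the locale supplies only these
  and their Taylor estimates.\<close>

definition A1 :: "real^'n \<Rightarrow> real^'n \<Rightarrow> real^'n" where
  "A1 a v = (\<Sum>k\<in>UNIV. v $ k *\<^sub>R F1 k a)"

text \<open>The second derivative of V as a bilinear form. The slot \<open>w\<close> belongs to the
  later differentiation: in \<open>A1_taylor\<close> it receives the increment of the base point,
  whereas \<open>v\<close> is the vector to which DV is applied.\<close>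

definition A2 :: "real^'n \<Rightarrow> real^'n \<Rightarrow> real^'n \<Rightarrow> real^'n" where
  "A2 a v w = (\<Sum>k\<in>UNIV. v $ k *\<^sub>R (\<Sum>l\<in>UNIV. w $ l *\<^sub>R F2 k l a))"

lemma linear_A1: "linear (A1 a)"
  unfolding A1_def
  by (rule linearI) (simp_all add: scaleR_left_distrib sum.distrib scaleR_sum_right)

lemma A2_diff_left: "A2 a (v - v') w = A2 a v w - A2 a v' w"
  by (simp add: A2_def scaleR_left_diff_distrib sum_subtractf)

lemma A2_diff_right: "A2 a v (w - w') = A2 a v w - A2 a v w'"
  by (simp add: A2_def scaleR_left_diff_distrib scaleR_right_diff_distrib sum_subtractf)

lemma A2_scaleR_right: "A2 a v (c *\<^sub>R w) = c *\<^sub>R A2 a v w"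
  by (simp add: A2_def scaleR_sum_right mult_ac)

lemma A1_le: "a \<in> U \<Longrightarrow> l1 (A1 a v) \<le> D1 * l1 v"
  unfolding A1_def
  by (rule order_trans [OF F1_le]) (auto intro: mult_left_mono infnorm_le_l1 nonneg)

lemma A1_diff_le:
  assumes "a \<in> U" "b \<in> U"
  shows "l1 (A1 b v - A1 a v) \<le> D2 * infnorm (b - a) * l1 v"
proof -
  have "A1 b v - A1 a v = (\<Sum>k\<in>UNIV. v $ k *\<^sub>R (F1 k b - F1 k a))"
    by (simp add: A1_def scaleR_right_diff_distrib sum_subtractf)
  also have "l1 \<dots> \<le> D2 * infnorm (b - a) * l1 v"
    by (rule l1_sum_scaleR [OF F1_lip [OF assms]])
  finally show ?thesis .
qed

lemma A1_taylor:
  assumes "a \<in> U" "b \<in> U"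
  shows "l1 (A1 b v - A1 a v - A2 a v (b - a)) \<le> C * (infnorm (b - a))\<^sup>2 * l1 v"
proof -
  have "A1 b v - A1 a v - A2 a v (b - a)
      = (\<Sum>k\<in>UNIV. v $ k *\<^sub>R (F1 k b - F1 k a - (\<Sum>l\<in>UNIV. (b - a) $ l *\<^sub>R F2 k l a)))"
    by (simp add: A1_def A2_def scaleR_right_diff_distrib sum_subtractf)
  also have "l1 \<dots> \<le> C * (infnorm (b - a))\<^sup>2 * l1 v"
    by (rule l1_sum_scaleR [OF F1_taylor [OF assms]])
  finally show ?thesis .
qed

lemma A2_le: "a \<in> U \<Longrightarrow> l1 (A2 a v w) \<le> D2 * infnorm w * l1 v"
  unfolding A2_def by (rule l1_sum_scaleR [OF F2_le])

lemma A2_le_l1: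
  assumes "a \<in> U" "l1 w \<le> p" "l1 v \<le> q"
  shows "l1 (A2 a v w) \<le> D2 * p * q"
proof -
  have "l1 (A2 a v w) \<le> D2 * infnorm w * l1 v"
    by (rule A2_le [OF assms(1)])
  also have "\<dots> \<le> D2 * p * q"
  proof (intro mult_mono)
    show "infnorm w \<le> p" using infnorm_le_l1 assms(2) by (rule order_trans)
    then show "0 \<le> D2 * p" using infnorm_pos_le [of w] nonneg by simp
  qed (use nonneg infnorm_pos_le assms(3) in auto)
  finally show ?thesis .
qed

lemma A2_diff_le:
  assumes "a \<in> U" "b \<in> U"
  shows "l1 (A2 b v w - A2 a v w) \<le> D3 * infnorm (b - a) * l1 w * l1 v"
proof -
  have "A2 b v w - A2 a v w
      = (\<Sum>k\<in>UNIV. v $ k *\<^sub>R (\<Sum>l\<in>UNIV. w $ l *\<^sub>R (F2 k l b - F2 k l a)))"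
    by (simp add: A2_def scaleR_right_diff_distrib sum_subtractf)
  also have "l1 \<dots> \<le> D3 * infnorm (b - a) * l1 w * l1 v"
    by (intro l1_sum_scaleR F2_lip assms)
  finally show ?thesis .
qed

lemma enlarge_step:
  assumes "x \<in> enlarge K r" "\<bar>u\<bar> < 1"
  shows "x + u *\<^sub>R axis i 1 \<in> enlarge K (r + 1)"
  using enlarge_add [OF assms(1), of "u *\<^sub>R axis i 1" 1] assms(2) by simp

section \<open>The first variational equation: D_i Y and its increments\<close>

lemma tendsto_quotient_Y:
  assumes x: "x \<in> enlarge K 2"
  obtains J where
    "\<And>u t. 0 < \<bar>u\<bar> \<Longrightarrow> \<bar>u\<bar> < 1 \<Longrightarrow> t \<in> {0..\<tau>} \<Longrightarrow>
      l1 ((Y (x + u *\<^sub>R axis i 1) t - Y x t) /\<^sub>R u - J t) \<le> 2 * (4 * C) * \<tau> * \<bar>u\<bar>"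
    "(\<lambda>s. A1 (Y x s) (J s)) integrable_on {0..\<tau>}"
    "\<And>t. t \<in> {0..\<tau>} \<Longrightarrow> J t = axis i 1 + integral {0..t} (\<lambda>s. A1 (Y x s) (J s))"
    "\<And>t. t \<in> {0..\<tau>} \<Longrightarrow> l1 (J t) \<le> 2"
proof -
  define Yu where "Yu u = Y (x + u *\<^sub>R axis i 1)" for u
  have x3: "x \<in> enlarge K 3" using x enlarge_mono [of 2 3 K] by auto
  have xu: "x + u *\<^sub>R axis i 1 \<in> enlarge K 3" if "\<bar>u\<bar> < 1" for u
    using enlarge_step [OF x that] by simp
  note Y_U = Y_in [OF x3]
  note Yu_U = Y_in [OF xu, folded Yu_def]
  have Yu_le: "infnorm (Yu u t - Y x t) \<le> 2 * \<bar>u\<bar>" if "\<bar>u\<bar> < 1" "t \<in> {0..\<tau>}" for u t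
    using Y_lip [OF x3 xu [OF that(1)] that(2)] by (simp add: Yu_def)
  \<comment> \<open>The quotients start from e_i exactly. Since increments of Y are at most 2
    \<bar>u\<bar>, the Taylor remainder divided by \<bar>u\<bar> is at most C (2 \<bar>u\<bar>)^2 /
    \<bar>u\<bar>, whence E = 4 C.\<close>
  show thesis
  proof (rule integral_equation_limit [where r = 1 and \<tau> = \<tau> and D = D1 and E = "4 * C"
        and A = "\<lambda>s. A1 (Y x s)" and b = "\<lambda>_. 0" and M = 0 and c = "axis i 1"
        and Q = "\<lambda>u t. (Yu u t - Y x t) /\<^sub>R u" and q = "\<lambda>u s. (V (Yu u s) - V (Y x s)) /\<^sub>R u"])
    show "linear (A1 (Y x s))" for s by (rule linear_A1)
    show "l1 (A1 (Y x s) v) \<le> D1 * l1 v" if "s \<in> {0..\<tau>}" for s v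
      by (rule A1_le [OF Y_U [OF that]])
    fix u :: real
    assume u: "0 < \<bar>u\<bar>" "\<bar>u\<bar> < 1"
    have int: "(\<lambda>s. V (Yu u s) - V (Y x s)) integrable_on {0..\<tau>}"
      unfolding Yu_def by (intro integrable_diff Y_int xu x3 u)
    then show "(\<lambda>s. (V (Yu u s) - V (Y x s)) /\<^sub>R u) integrable_on {0..\<tau>}"
      by (rule integrable_cmul)
    show "(Yu u t - Y x t) /\<^sub>R u = axis i 1 + integral {0..t} (\<lambda>s. (V (Yu u s) - V (Y x s)) /\<^sub>R u)"
      if t: "t \<in> {0..\<tau>}" for t
      using Y_eq [OF x3 xu [OF u(2)] t] u(1) by (simp add: Yu_def scaleR_right_distrib)
    show "l1 ((V (Yu u s) - V (Y x s)) /\<^sub>R u - (A1 (Y x s) ((Yu u s - Y x s) /\<^sub>R u) + 0)) \<le> 4 * C * \<bar>u\<bar>"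
      if s: "s \<in> {0..\<tau>}" for s
    proof -
      have "(V (Yu u s) - V (Y x s)) /\<^sub>R u - (A1 (Y x s) ((Yu u s - Y x s) /\<^sub>R u) + 0)
          = (V (Yu u s) - V (Y x s) - A1 (Y x s) (Yu u s - Y x s)) /\<^sub>R u"
        by (simp only: linear_scale [OF linear_A1] add_0_right scaleR_right_diff_distrib [symmetric])
      also have "l1 \<dots> = l1 (V (Yu u s) - V (Y x s) - A1 (Y x s) (Yu u s - Y x s)) / \<bar>u\<bar>"
        by (simp add: divide_inverse mult.commute)
      also have "\<dots> \<le> C * (2 * \<bar>u\<bar>)\<^sup>2 / \<bar>u\<bar>"
      proof (rule divide_right_mono)
        have "l1 (V (Yu u s) - V (Y x s) - A1 (Y x s) (Yu u s - Y x s)) \<le> C * (infnorm (Yu u s - Y x s))\<^sup>2"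
          unfolding A1_def by (rule V_taylor [OF Y_U [OF s] Yu_U [OF u(2) s]])
        also have "\<dots> \<le> C * (2 * \<bar>u\<bar>)\<^sup>2"
          by (intro mult_left_mono power_mono Yu_le infnorm_pos_le nonneg u s)
        finally show "l1 (V (Yu u s) - V (Y x s) - A1 (Y x s) (Yu u s - Y x s)) \<le> C * (2 * \<bar>u\<bar>)\<^sup>2" .
      qed simp
      also have "\<dots> = 4 * C * \<bar>u\<bar>" using u by (simp add: power2_eq_square field_simps)
      finally show ?thesis .
    qed
  next
    fix L
    assume L: "\<And>u t. 0 < \<bar>u\<bar> \<Longrightarrow> \<bar>u\<bar> < 1 \<Longrightarrow> t \<in> {0..\<tau>} \<Longrightarrow>
        l1 ((Yu u t - Y x t) /\<^sub>R u - L t) \<le> 2 * (4 * C) * \<tau> * \<bar>u\<bar>"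
      "(\<lambda>s. A1 (Y x s) (L s) + 0) integrable_on {0..\<tau>}"
      "\<And>t. t \<in> {0..\<tau>} \<Longrightarrow> L t = axis i 1 + integral {0..t} (\<lambda>s. A1 (Y x s) (L s) + 0)"
      "\<And>t. t \<in> {0..\<tau>} \<Longrightarrow> l1 (L t) \<le> 2 * (l1 (axis i 1 :: real^'n) + 0 * \<tau>)"
    from L(4) have "l1 (L t) \<le> 2" if "t \<in> {0..\<tau>}" for t
      using that by fastforce
    with L(1-3) show thesis
      unfolding Yu_def add_0_right by (rule that)
  qed (use nonneg D1_\<tau> in auto)
qed

definition J :: "'n \<Rightarrow> real^'n \<Rightarrow> real \<Rightarrow> real^'n" where
  "J i x t = partial i (\<lambda>z. Y z t) x"

text \<open>The limits so far were obtained for each x separately. Identifying them with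
  \<open>J\<close> makes them one function of x, whose own difference quotients can then be
  formed.\<close>

lemma partial_Y:
  assumes x: "x \<in> enlarge K 2"
  shows partial_exists_Y: "t \<in> {0..\<tau>} \<Longrightarrow> partial_exists i (\<lambda>z. Y z t) x"
    and J_approx: "0 < \<bar>u\<bar> \<Longrightarrow> \<bar>u\<bar> < 1 \<Longrightarrow> t \<in> {0..\<tau>} \<Longrightarrow>
      l1 ((Y (x + u *\<^sub>R axis i 1) t - Y x t) /\<^sub>R u - J i x t) \<le> 8 * C * \<tau> * \<bar>u\<bar>"
    and J_int: "(\<lambda>s. A1 (Y x s) (J i x s)) integrable_on {0..\<tau>}"
    and J_eq: "t \<in> {0..\<tau>} \<Longrightarrow> J i x t = axis i 1 + integral {0..t} (\<lambda>s. A1 (Y x s) (J i x s))"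
    and J_le: "t \<in> {0..\<tau>} \<Longrightarrow> l1 (J i x t) \<le> 2"
proof -
  obtain L where L:
    "\<And>u t. 0 < \<bar>u\<bar> \<Longrightarrow> \<bar>u\<bar> < 1 \<Longrightarrow> t \<in> {0..\<tau>} \<Longrightarrow>
      l1 ((Y (x + u *\<^sub>R axis i 1) t - Y x t) /\<^sub>R u - L t) \<le> 2 * (4 * C) * \<tau> * \<bar>u\<bar>"
    "(\<lambda>s. A1 (Y x s) (L s)) integrable_on {0..\<tau>}"
    "\<And>t. t \<in> {0..\<tau>} \<Longrightarrow> L t = axis i 1 + integral {0..t} (\<lambda>s. A1 (Y x s) (L s))"
    "\<And>t. t \<in> {0..\<tau>} \<Longrightarrow> l1 (L t) \<le> 2"
    by (rule tendsto_quotient_Y [OF x, where i = i]) (rule that)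
  have lim: "((\<lambda>u. (Y (x + u *\<^sub>R axis i 1) t - Y x t) /\<^sub>R u) \<longlongrightarrow> L t) (at 0)" if "t \<in> {0..\<tau>}" for t
    using l1_tendsto_at_0 [OF zero_less_one L(1) [OF _ _ that]] .
  have J: "J i x t = L t" if "t \<in> {0..\<tau>}" for t
    unfolding J_def partial_def using tendsto_Lim [OF _ lim [OF that]] by simp
  show "t \<in> {0..\<tau>} \<Longrightarrow> partial_exists i (\<lambda>z. Y z t) x"
    unfolding partial_exists_def using lim by blast
  show "0 < \<bar>u\<bar> \<Longrightarrow> \<bar>u\<bar> < 1 \<Longrightarrow> t \<in> {0..\<tau>} \<Longrightarrow>
      l1 ((Y (x + u *\<^sub>R axis i 1) t - Y x t) /\<^sub>R u - J i x t) \<le> 8 * C * \<tau> * \<bar>u\<bar>"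
    using L(1) [of u t] J [of t] by simp
  show "(\<lambda>s. A1 (Y x s) (J i x s)) integrable_on {0..\<tau>}"
    by (rule integrable_eq [OF L(2)]) (simp add: J)
  have "integral {0..t} (\<lambda>s. A1 (Y x s) (J i x s)) = integral {0..t} (\<lambda>s. A1 (Y x s) (L s))"
    if "t \<in> {0..\<tau>}"
    using that by (intro integral_cong) (simp add: J)
  then show "t \<in> {0..\<tau>} \<Longrightarrow> J i x t = axis i 1 + integral {0..t} (\<lambda>s. A1 (Y x s) (J i x s))"
    using L(3) [of t] J [of t] by simp
  show "t \<in> {0..\<tau>} \<Longrightarrow> l1 (J i x t) \<le> 2"
    using L(4) J by simp
qed

text \<open>Both derivatives start from e_i, so only the change of the coefficient DV drives the
  difference. The constant 8 is 2 from the increment of Y, 2 from the bound on D_i Y and 2 from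
  absorption.\<close>

lemma J_diff_le:
  assumes x: "x \<in> enlarge K 2" "x' \<in> enlarge K 2" and t: "t \<in> {0..\<tau>}"
  shows "l1 (J i x' t - J i x t) \<le> 8 * D2 * \<tau> * infnorm (x' - x)"
proof -
  have x3: "x \<in> enlarge K 3" "x' \<in> enlarge K 3"
    using x enlarge_mono [of 2 3 K] by auto
  have "l1 (J i x' t - J i x t) \<le> 2 * (l1 (0 :: real^'n) + 4 * D2 * infnorm (x' - x) * \<tau>)"
  proof (rule l1_integral_equation_le [OF nonneg(1) D1_\<tau>])
    show "(\<lambda>s. A1 (Y x' s) (J i x' s) - A1 (Y x s) (J i x s)) integrable_on {0..\<tau>}"
      by (intro integrable_diff J_int x)
    show "J i x' t - J i x t = 0 + integral {0..t} (\<lambda>s. A1 (Y x' s) (J i x' s) - A1 (Y x s) (J i x s))"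
      if t: "t \<in> {0..\<tau>}" for t
      using J_eq [OF x(1) t, of i] J_eq [OF x(2) t, of i]
      by (simp add: integral_diff integrable_on_initial_segment [OF J_int t] x)
    show "l1 (A1 (Y x' s) (J i x' s) - A1 (Y x s) (J i x s))
        \<le> 4 * D2 * infnorm (x' - x) + D1 * l1 (J i x' s - J i x s)" if s: "s \<in> {0..\<tau>}" for s
    proof -
      have "A1 (Y x' s) (J i x' s) - A1 (Y x s) (J i x s)
          = (A1 (Y x' s) (J i x' s) - A1 (Y x s) (J i x' s)) + A1 (Y x s) (J i x' s - J i x s)"
        by (simp add: linear_diff [OF linear_A1])
      also have "l1 \<dots> \<le> D2 * (2 * infnorm (x' - x)) * 2 + D1 * l1 (J i x' s - J i x s)"
      proof (intro l1_add_le)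
        have "l1 (A1 (Y x' s) (J i x' s) - A1 (Y x s) (J i x' s)) \<le> D2 * infnorm (Y x' s - Y x s) * l1 (J i x' s)"
          by (intro A1_diff_le Y_in x3 s)
        also have "\<dots> \<le> D2 * (2 * infnorm (x' - x)) * 2"
          using nonneg Y_lip [OF x3 s] J_le [OF x(2) s]
          by (intro mult_mono mult_nonneg_nonneg infnorm_pos_le) (auto simp: infnorm_pos_le)
        finally show "l1 (A1 (Y x' s) (J i x' s) - A1 (Y x s) (J i x' s)) \<le> D2 * (2 * infnorm (x' - x)) * 2" .
      qed (rule A1_le [OF Y_in [OF x3(1) s]])
      finally show ?thesis by simp
    qed
  qed (use t nonneg in \<open>auto simp: infnorm_pos_le\<close>)
  then show ?thesis by (simp add: algebra_simps)
qed

section \<open>The second variational equation: D_ik Y and its increments\<close>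

lemma tendsto_quotient_J:
  assumes x: "x \<in> enlarge K 1"
  obtains E L where
    "\<And>u t. 0 < \<bar>u\<bar> \<Longrightarrow> \<bar>u\<bar> < 1 \<Longrightarrow> t \<in> {0..\<tau>} \<Longrightarrow>
      l1 ((J i (x + u *\<^sub>R axis k 1) t - J i x t) /\<^sub>R u - L t) \<le> E * \<bar>u\<bar>"
    "(\<lambda>s. A1 (Y x s) (L s) + A2 (Y x s) (J i x s) (J k x s)) integrable_on {0..\<tau>}"
    "\<And>t. t \<in> {0..\<tau>} \<Longrightarrow>
      L t = integral {0..t} (\<lambda>s. A1 (Y x s) (L s) + A2 (Y x s) (J i x s) (J k x s))"
    "\<And>t. t \<in> {0..\<tau>} \<Longrightarrow> l1 (L t) \<le> 8 * D2 * \<tau>"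
proof -
  define Yu where "Yu u = Y (x + u *\<^sub>R axis k 1)" for u
  define Ju where "Ju u = J i (x + u *\<^sub>R axis k 1)" for u
  \<comment> \<open>The three terms are the Taylor remainder of DV, the error of replacing the
    quotient of Y by D_k Y, and the error of replacing D_i Y at the shifted point by D_i Y at
    x.\<close>
  define E where "E = 8 * C + 16 * C * D2 * \<tau> + 16 * D2 * D2 * \<tau>"
  have x2: "x \<in> enlarge K 2" using x enlarge_mono [of 1 2 K] by auto
  then have x3: "x \<in> enlarge K 3" using enlarge_mono [of 2 3 K] by auto
  have xu2: "x + u *\<^sub>R axis k 1 \<in> enlarge K 2" if "\<bar>u\<bar> < 1" for u
    using enlarge_step [OF x that] by simp
  then have xu3: "x + u *\<^sub>R axis k 1 \<in> enlarge K 3" if "\<bar>u\<bar> < 1" for u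
    using that enlarge_mono [of 2 3 K] by auto
  note Y_U = Y_in [OF x3]
  note Yu_U = Y_in [OF xu3, folded Yu_def]
  have Yu_le: "infnorm (Yu u t - Y x t) \<le> 2 * \<bar>u\<bar>" if "\<bar>u\<bar> < 1" "t \<in> {0..\<tau>}" for u t
    using Y_lip [OF x3 xu3 [OF that(1)] that(2)] by (simp add: Yu_def)
  have Ju_le: "l1 (Ju u t) \<le> 2" if "\<bar>u\<bar> < 1" "t \<in> {0..\<tau>}" for u t
    unfolding Ju_def by (rule J_le [OF xu2 [OF that(1)] that(2)])
  \<comment> \<open>The initial value e_i does not depend on x, hence c = 0. The inhomogeneity is
    bounded by D2 times the bound 2 for each of D_i Y and D_k Y; absorption doubles 4 D2 \<tau> to
    the stated 8 D2 \<tau>.\<close>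
  show thesis
  proof (rule integral_equation_limit [where r = 1 and \<tau> = \<tau> and D = D1 and E = E
        and A = "\<lambda>s. A1 (Y x s)" and b = "\<lambda>s. A2 (Y x s) (J i x s) (J k x s)" and M = "4 * D2" and c = 0
        and Q = "\<lambda>u t. (Ju u t - J i x t) /\<^sub>R u"
        and q = "\<lambda>u s. (A1 (Yu u s) (Ju u s) - A1 (Y x s) (J i x s)) /\<^sub>R u"])
    show "linear (A1 (Y x s))" for s by (rule linear_A1)
    show "l1 (A1 (Y x s) v) \<le> D1 * l1 v" if "s \<in> {0..\<tau>}" for s v
      by (rule A1_le [OF Y_U [OF that]])
    show "l1 (A2 (Y x s) (J i x s) (J k x s)) \<le> 4 * D2" if s: "s \<in> {0..\<tau>}" for s
    proof -
      have "l1 (A2 (Y x s) (J i x s) (J k x s)) \<le> D2 * 2 * 2"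
        by (intro A2_le_l1 Y_U J_le x2 s)
      then show ?thesis by simp
    qed
    show "0 \<le> E" using nonneg by (simp add: E_def)
    fix u :: real
    assume u: "0 < \<bar>u\<bar>" "\<bar>u\<bar> < 1"
    show "(\<lambda>s. (A1 (Yu u s) (Ju u s) - A1 (Y x s) (J i x s)) /\<^sub>R u) integrable_on {0..\<tau>}"
      unfolding Yu_def Ju_def by (intro integrable_cmul integrable_diff J_int xu2 x2 u)
    show "(Ju u t - J i x t) /\<^sub>R u
        = 0 + integral {0..t} (\<lambda>s. (A1 (Yu u s) (Ju u s) - A1 (Y x s) (J i x s)) /\<^sub>R u)"
      if t: "t \<in> {0..\<tau>}" for t
      using J_eq [OF x2 t, of i] J_eq [OF xu2 [OF u(2)] t, of i]
      by (simp add: Yu_def Ju_def integral_diff integrable_on_initial_segment [OF J_int t] x2 xu2 [OF u(2)])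
    show "l1 ((A1 (Yu u s) (Ju u s) - A1 (Y x s) (J i x s)) /\<^sub>R u
        - (A1 (Y x s) ((Ju u s - J i x s) /\<^sub>R u) + A2 (Y x s) (J i x s) (J k x s))) \<le> E * \<bar>u\<bar>"
      if s: "s \<in> {0..\<tau>}" for s
    proof -
      \<comment> \<open>\<open>Ju u s\<close> is kept at the shifted point while the coefficient is
        expanded; only afterwards are the two slots of \<open>A2\<close> moved to their limits, one
        at a time.\<close>
      define T where "T = A1 (Yu u s) (Ju u s) - A1 (Y x s) (Ju u s) - A2 (Y x s) (Ju u s) (Yu u s - Y x s)"
      have "(A1 (Yu u s) (Ju u s) - A1 (Y x s) (J i x s)) /\<^sub>R u
          - (A1 (Y x s) ((Ju u s - J i x s) /\<^sub>R u) + A2 (Y x s) (J i x s) (J k x s))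
          = T /\<^sub>R u + A2 (Y x s) (Ju u s) ((Yu u s - Y x s) /\<^sub>R u - J k x s)
            + A2 (Y x s) (Ju u s - J i x s) (J k x s)"
        by (simp only: T_def linear_scale [OF linear_A1] linear_diff [OF linear_A1] A2_diff_left
            A2_diff_right A2_scaleR_right scaleR_right_diff_distrib) simp
      also have "l1 \<dots> \<le> 8 * C * \<bar>u\<bar> + D2 * (8 * C * \<tau> * \<bar>u\<bar>) * 2 + D2 * 2 * (8 * D2 * \<tau> * \<bar>u\<bar>)"
      proof (intro l1_add_le)
        have "l1 T \<le> C * (infnorm (Yu u s - Y x s))\<^sup>2 * l1 (Ju u s)"
          unfolding T_def by (rule A1_taylor [OF Y_U [OF s] Yu_U [OF u(2) s]])
        also have "\<dots> \<le> C * (2 * \<bar>u\<bar>)\<^sup>2 * 2"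
          using nonneg power_mono [OF Yu_le [OF u(2) s] infnorm_pos_le, of 2] Ju_le [OF u(2) s]
          by (intro mult_mono order_refl) auto
        finally have "l1 T / \<bar>u\<bar> \<le> C * (2 * \<bar>u\<bar>)\<^sup>2 * 2 / \<bar>u\<bar>" by (rule divide_right_mono) simp
        also have "\<dots> = 8 * C * \<bar>u\<bar>" using u by (simp add: power2_eq_square field_simps)
        finally show "l1 (T /\<^sub>R u) \<le> 8 * C * \<bar>u\<bar>" by (simp add: divide_inverse mult.commute)
        have "l1 ((Yu u s - Y x s) /\<^sub>R u - J k x s) \<le> 8 * C * \<tau> * \<bar>u\<bar>"
          unfolding Yu_def by (rule J_approx [OF x2 u s])
        with Ju_le [OF u(2) s] show "l1 (A2 (Y x s) (Ju u s) ((Yu u s - Y x s) /\<^sub>R u - J k x s)) \<le> D2 * (8 * C * \<tau> * \<bar>u\<bar>) * 2"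
          by (intro A2_le_l1 Y_U s)
        have "l1 (Ju u s - J i x s) \<le> 8 * D2 * \<tau> * \<bar>u\<bar>"
          unfolding Ju_def using J_diff_le [OF x2 xu2 [OF u(2)] s, of i] by simp
        with J_le [OF x2 s] show "l1 (A2 (Y x s) (Ju u s - J i x s) (J k x s)) \<le> D2 * 2 * (8 * D2 * \<tau> * \<bar>u\<bar>)"
          by (intro A2_le_l1 Y_U s)
      qed
      also have "\<dots> = E * \<bar>u\<bar>" by (simp add: E_def algebra_simps)
      finally show ?thesis .
    qed
  next
    fix L
    assume L: "\<And>u t. 0 < \<bar>u\<bar> \<Longrightarrow> \<bar>u\<bar> < 1 \<Longrightarrow> t \<in> {0..\<tau>} \<Longrightarrow>
        l1 ((Ju u t - J i x t) /\<^sub>R u - L t) \<le> 2 * E * \<tau> * \<bar>u\<bar>"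
      "(\<lambda>s. A1 (Y x s) (L s) + A2 (Y x s) (J i x s) (J k x s)) integrable_on {0..\<tau>}"
      "\<And>t. t \<in> {0..\<tau>} \<Longrightarrow>
        L t = 0 + integral {0..t} (\<lambda>s. A1 (Y x s) (L s) + A2 (Y x s) (J i x s) (J k x s))"
      "\<And>t. t \<in> {0..\<tau>} \<Longrightarrow> l1 (L t) \<le> 2 * (l1 (0 :: real^'n) + 4 * D2 * \<tau>)"
    have "l1 (L t) \<le> 8 * D2 * \<tau>" if "t \<in> {0..\<tau>}" for t
      using L(4) [OF that] by (simp add: mult.assoc)
    with L(1-3) show thesis
      unfolding Ju_def add_0_left by (rule that)
  qed (use nonneg D1_\<tau> in auto)
qed

definition H :: "'n \<Rightarrow> 'n \<Rightarrow> real^'n \<Rightarrow> real \<Rightarrow> real^'n" where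
  "H i k x t = partial k (\<lambda>z. J i z t) x"

lemma partial_J:
  assumes x: "x \<in> enlarge K 1"
  shows partial_exists_J: "t \<in> {0..\<tau>} \<Longrightarrow> partial_exists k (\<lambda>z. J i z t) x"
    and H_int: "(\<lambda>s. A1 (Y x s) (H i k x s) + A2 (Y x s) (J i x s) (J k x s)) integrable_on {0..\<tau>}"
    and H_eq: "t \<in> {0..\<tau>} \<Longrightarrow>
      H i k x t = integral {0..t} (\<lambda>s. A1 (Y x s) (H i k x s) + A2 (Y x s) (J i x s) (J k x s))"
    and H_le: "t \<in> {0..\<tau>} \<Longrightarrow> l1 (H i k x t) \<le> 8 * D2 * \<tau>"
proof -
  obtain E L where L:
    "\<And>u t. 0 < \<bar>u\<bar> \<Longrightarrow> \<bar>u\<bar> < 1 \<Longrightarrow> t \<in> {0..\<tau>} \<Longrightarrow>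
      l1 ((J i (x + u *\<^sub>R axis k 1) t - J i x t) /\<^sub>R u - L t) \<le> E * \<bar>u\<bar>"
    "(\<lambda>s. A1 (Y x s) (L s) + A2 (Y x s) (J i x s) (J k x s)) integrable_on {0..\<tau>}"
    "\<And>t. t \<in> {0..\<tau>} \<Longrightarrow>
      L t = integral {0..t} (\<lambda>s. A1 (Y x s) (L s) + A2 (Y x s) (J i x s) (J k x s))"
    "\<And>t. t \<in> {0..\<tau>} \<Longrightarrow> l1 (L t) \<le> 8 * D2 * \<tau>"
    by (rule tendsto_quotient_J [OF x, where i = i and k = k]) (rule that)
  have lim: "((\<lambda>u. (J i (x + u *\<^sub>R axis k 1) t - J i x t) /\<^sub>R u) \<longlongrightarrow> L t) (at 0)" if "t \<in> {0..\<tau>}" for t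
    using l1_tendsto_at_0 [OF zero_less_one L(1) [OF _ _ that]] .
  have H: "H i k x t = L t" if "t \<in> {0..\<tau>}" for t
    unfolding H_def partial_def using tendsto_Lim [OF _ lim [OF that]] by simp
  show "t \<in> {0..\<tau>} \<Longrightarrow> partial_exists k (\<lambda>z. J i z t) x"
    unfolding partial_exists_def using lim by blast
  show "(\<lambda>s. A1 (Y x s) (H i k x s) + A2 (Y x s) (J i x s) (J k x s)) integrable_on {0..\<tau>}"
    by (rule integrable_eq [OF L(2)]) (simp add: H)
  have "integral {0..t} (\<lambda>s. A1 (Y x s) (H i k x s) + A2 (Y x s) (J i x s) (J k x s))
      = integral {0..t} (\<lambda>s. A1 (Y x s) (L s) + A2 (Y x s) (J i x s) (J k x s))"
    if "t \<in> {0..\<tau>}"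
    using that by (intro integral_cong) (simp add: H)
  then show "t \<in> {0..\<tau>} \<Longrightarrow>
      H i k x t = integral {0..t} (\<lambda>s. A1 (Y x s) (H i k x s) + A2 (Y x s) (J i x s) (J k x s))"
    using L(3) [of t] H [of t] by simp
  show "t \<in> {0..\<tau>} \<Longrightarrow> l1 (H i k x t) \<le> 8 * D2 * \<tau>"
    using L(4) H by simp
qed

text \<open>Changing one argument at a time leaves four sources and one absorbed term. The change of
  DV acting on D_ik Y and the changes of the two slots of D^2 V contribute 16 D2^2 \<tau> each,
  which is 48; the change of D^2 V itself contributes 2 * 2 * 2 D3. Absorption over [0, \<tau>]
  doubles these to 96 and 16 and supplies another factor \<tau>.\<close>

lemma H_diff_le:
  assumes x: "x \<in> enlarge K 1" "x' \<in> enlarge K 1" and t: "t \<in> {0..\<tau>}"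
  shows "l1 (H i k x' t - H i k x t)
    \<le> 96 * D2\<^sup>2 * \<tau>\<^sup>2 * infnorm (x' - x) + 16 * D3 * \<tau> * infnorm (x' - x)"
proof -
  have x2: "x \<in> enlarge K 2" "x' \<in> enlarge K 2" and x3: "x \<in> enlarge K 3" "x' \<in> enlarge K 3"
    using x enlarge_mono [of 1 2 K] enlarge_mono [of 1 3 K] by auto
  define d where "d = infnorm (x' - x)"
  have "0 \<le> d" by (simp add: d_def infnorm_pos_le)
  have "l1 (H i k x' t - H i k x t) \<le> 2 * (l1 (0 :: real^'n) + (48 * D2\<^sup>2 * \<tau> * d + 8 * D3 * d) * \<tau>)"
  proof (rule l1_integral_equation_le [OF nonneg(1) D1_\<tau>])
    let ?h = "\<lambda>x s. A1 (Y x s) (H i k x s) + A2 (Y x s) (J i x s) (J k x s)"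
    show "(\<lambda>s. ?h x' s - ?h x s) integrable_on {0..\<tau>}"
      by (intro integrable_diff H_int x)
    show "H i k x' t - H i k x t = 0 + integral {0..t} (\<lambda>s. ?h x' s - ?h x s)" if t: "t \<in> {0..\<tau>}" for t
      using H_eq [OF x(1) t, of i k] H_eq [OF x(2) t, of i k]
      by (simp add: integral_diff integrable_on_initial_segment [OF H_int t] x)
    show "l1 (?h x' s - ?h x s) \<le> 48 * D2\<^sup>2 * \<tau> * d + 8 * D3 * d + D1 * l1 (H i k x' s - H i k x s)"
      if s: "s \<in> {0..\<tau>}" for s
    proof -
      note Y_U = Y_in [OF x3(1) s] and Y_U' = Y_in [OF x3(2) s]
      have Yd: "infnorm (Y x' s - Y x s) \<le> 2 * d"
        unfolding d_def by (rule Y_lip [OF x3 s])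
      have Jd: "l1 (J j x' s - J j x s) \<le> 8 * D2 * \<tau> * d" for j
        unfolding d_def by (rule J_diff_le [OF x2 s])
      have eq: "?h x' s - ?h x s
          = (A1 (Y x' s) (H i k x' s) - A1 (Y x s) (H i k x' s))
          + (A2 (Y x' s) (J i x' s) (J k x' s) - A2 (Y x s) (J i x' s) (J k x' s))
          + A2 (Y x s) (J i x' s - J i x s) (J k x' s)
          + A2 (Y x s) (J i x s) (J k x' s - J k x s)
          + A1 (Y x s) (H i k x' s - H i k x s)"
        by (simp add: linear_diff [OF linear_A1] A2_diff_left A2_diff_right)
      have "l1 (?h x' s - ?h x s) \<le> D2 * (2 * d) * (8 * D2 * \<tau>) + D3 * (2 * d) * 2 * 2
          + D2 * 2 * (8 * D2 * \<tau> * d) + D2 * (8 * D2 * \<tau> * d) * 2 + D1 * l1 (H i k x' s - H i k x s)"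
        unfolding eq
      proof (intro l1_add_le)
        have "l1 (A1 (Y x' s) (H i k x' s) - A1 (Y x s) (H i k x' s))
            \<le> D2 * infnorm (Y x' s - Y x s) * l1 (H i k x' s)"
          by (rule A1_diff_le [OF Y_U Y_U'])
        also have "\<dots> \<le> D2 * (2 * d) * (8 * D2 * \<tau>)"
          using nonneg \<open>0 \<le> d\<close> Yd H_le [OF x(2) s]
          by (intro mult_mono mult_nonneg_nonneg infnorm_pos_le) auto
        finally show "l1 (A1 (Y x' s) (H i k x' s) - A1 (Y x s) (H i k x' s)) \<le> D2 * (2 * d) * (8 * D2 * \<tau>)" .
        have "l1 (A2 (Y x' s) (J i x' s) (J k x' s) - A2 (Y x s) (J i x' s) (J k x' s))
            \<le> D3 * infnorm (Y x' s - Y x s) * l1 (J k x' s) * l1 (J i x' s)"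
          by (rule A2_diff_le [OF Y_U Y_U'])
        also have "\<dots> \<le> D3 * (2 * d) * 2 * 2"
          using nonneg \<open>0 \<le> d\<close> Yd J_le [OF x2(2) s]
          by (intro mult_mono mult_nonneg_nonneg infnorm_pos_le) auto
        finally show "l1 (A2 (Y x' s) (J i x' s) (J k x' s) - A2 (Y x s) (J i x' s) (J k x' s))
            \<le> D3 * (2 * d) * 2 * 2" .
        show "l1 (A2 (Y x s) (J i x' s - J i x s) (J k x' s)) \<le> D2 * 2 * (8 * D2 * \<tau> * d)"
          by (intro A2_le_l1 Y_U Jd J_le x2 s)
        show "l1 (A2 (Y x s) (J i x s) (J k x' s - J k x s)) \<le> D2 * (8 * D2 * \<tau> * d) * 2"
          by (intro A2_le_l1 Y_U Jd J_le x2 s)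
      qed (rule A1_le [OF Y_U])
      also have "\<dots> = 48 * D2\<^sup>2 * \<tau> * d + 8 * D3 * d + D1 * l1 (H i k x' s - H i k x s)"
        by (simp add: power2_eq_square)
      finally show ?thesis .
    qed
  qed (use t nonneg \<open>0 \<le> d\<close> in auto)
  then show ?thesis by (simp add: d_def power2_eq_square algebra_simps)
qed

end

section \<open>Two-sided bounds for the flow and its range\<close>

context
  fixes V :: "real^'n \<Rightarrow> real^'n" and M S :: "(real^'n) set" and p :: "real \<Rightarrow> real^'n"
    and Y :: "real^'n \<Rightarrow> real \<Rightarrow> real^'n" and D \<tau> :: real
  assumes D: "0 \<le> D" "D * \<tau> \<le> 1/2"
    and lip: "\<And>a b. a \<in> M \<Longrightarrow> b \<in> M \<Longrightarrow> l1 (V b - V a) \<le> D * infnorm (b - a)"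
    and Y_in: "\<And>x t. x \<in> S \<Longrightarrow> t \<in> {0..\<tau>} \<Longrightarrow> Y x t \<in> M"
    and Y_int: "\<And>x. x \<in> S \<Longrightarrow> (\<lambda>s. V (Y x s)) integrable_on {0..\<tau>}"
    and Y_eq: "\<And>x t. x \<in> S \<Longrightarrow> t \<in> {0..\<tau>} \<Longrightarrow> Y x t = x + p t + integral {0..t} (\<lambda>s. V (Y x s))"
begin

lemma flow_diff_integrable:
  assumes "x \<in> S" "x' \<in> S" "0 \<le> s" "t \<le> \<tau>"
  shows "(\<lambda>s. V (Y x' s) - V (Y x s)) integrable_on {s..t}"
proof -
  have "(\<lambda>s. V (Y x' s) - V (Y x s)) integrable_on {0..\<tau>}"
    by (intro integrable_diff Y_int assms)
  then show ?thesis
    using assms integrable_on_subinterval by (metis atLeastatMost_subset_iff)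
qed

lemma flow_diff_eq:
  assumes x: "x \<in> S" "x' \<in> S" and t: "t \<in> {0..\<tau>}"
  shows "Y x' t - Y x t = (x' - x) + integral {0..t} (\<lambda>s. V (Y x' s) - V (Y x s))"
proof -
  have "(\<lambda>s. V (Y z s)) integrable_on {0..t}" if "z \<in> S" for z
    by (rule integrable_on_initial_segment [OF Y_int [OF that] t])
  then show ?thesis
    using x by (simp add: Y_eq [OF x(1) t] Y_eq [OF x(2) t] integral_diff)
qed

text \<open>The trajectories may jump with \<open>p\<close>, but \<open>p\<close> cancels in the
  difference, which is an indefinite integral up to a constant and hence continuous.\<close>

lemma flow_diff_bounded:
  assumes x: "x \<in> S" "x' \<in> S"
  obtains R where "\<And>t. t \<in> {0..\<tau>} \<Longrightarrow> infnorm (Y x' t - Y x t) \<le> R"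
proof -
  have "continuous_on {0..\<tau>} (\<lambda>t. infnorm ((x' - x) + integral {0..t} (\<lambda>s. V (Y x' s) - V (Y x s))))"
    by (intro continuous_intros indefinite_integral_continuous_1 flow_diff_integrable x) auto
  then have "continuous_on {0..\<tau>} (\<lambda>t. infnorm (Y x' t - Y x t))"
    by (rule continuous_on_eq) (simp add: flow_diff_eq x)
  then have "bounded ((\<lambda>t. infnorm (Y x' t - Y x t)) ` {0..\<tau>})"
    by (intro compact_imp_bounded compact_continuous_image) auto
  then have "\<exists>R. \<forall>t\<in>{0..\<tau>}. infnorm (Y x' t - Y x t) \<le> R"
    by (simp add: bounded_iff real_abs_infnorm)
  then show thesis using that by blast
qed

text \<open>The Lipschitz bound for V takes the max norm to the l1 norm, so the absorbed quantity is
  the max norm while the integral is estimated in l1; \<open>infnorm_le_l1\<close> closes the loop.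
  This is why \<open>half_absorption\<close> keeps \<open>f\<close> apart from
  \<open>z\<close>.\<close>

lemma flow_lipschitz:
  assumes x: "x \<in> S" "x' \<in> S" and t: "t \<in> {0..\<tau>}"
  shows "infnorm (Y x' t - Y x t) \<le> 2 * infnorm (x' - x)"
proof -
  obtain R where R: "\<And>t. t \<in> {0..\<tau>} \<Longrightarrow> infnorm (Y x' t - Y x t) \<le> R"
    using flow_diff_bounded [OF x] by blast
  have "infnorm (Y x' t - Y x t) \<le> 2 * (infnorm (x' - x) + 0 * \<tau>)"
  proof (rule half_absorption [OF D, where f = "\<lambda>t. infnorm (Y x' t - Y x t)" and a = "\<lambda>_. 0" and b = "\<lambda>t. t"
        and z = "\<lambda>s. V (Y x' s) - V (Y x s)" and R = R])
    fix s assume s: "s \<in> {0..\<tau>}"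
    show "(\<lambda>s. V (Y x' s) - V (Y x s)) integrable_on {0..s}"
      using s by (intro flow_diff_integrable x) auto
    show "l1 (V (Y x' s) - V (Y x s)) \<le> 0 + D * infnorm (Y x' s - Y x s)"
      using lip [OF Y_in [OF x(1) s] Y_in [OF x(2) s]] by simp
    show "infnorm (Y x' s - Y x s) \<le> infnorm (x' - x) + l1 (integral {0..s} (\<lambda>s. V (Y x' s) - V (Y x s)))"
      unfolding flow_diff_eq [OF x s]
      by (intro order_trans [OF infnorm_triangle] add_left_mono infnorm_le_l1)
  qed (use R t infnorm_pos_le in auto)
  then show ?thesis by simp
qed

text \<open>The same absorption run backwards from time t: two trajectories that are close at t were
  close at time 0. The result is injectivity of the flow in x, needed for invariance of
  domain.\<close>

lemma flow_expansive:
  assumes x: "x \<in> S" "x' \<in> S" and t: "t \<in> {0..\<tau>}"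
  shows "infnorm (x' - x) \<le> 2 * infnorm (Y x' t - Y x t)"
proof -
  define z where "z s = V (Y x' s) - V (Y x s)" for s
  obtain R where R: "\<And>t. t \<in> {0..\<tau>} \<Longrightarrow> infnorm (Y x' t - Y x t) \<le> R"
    using flow_diff_bounded [OF x] by blast
  have D_t: "D * t \<le> 1/2"
    using t mult_left_mono [of t \<tau> D] D by auto
  \<comment> \<open>The integration intervals are now [s, t] with t fixed, and the estimate is read
    off at s = 0.\<close>
  have "infnorm (Y x' 0 - Y x 0) \<le> 2 * (infnorm (Y x' t - Y x t) + 0 * t)"
  proof (rule half_absorption [OF D(1) D_t, where f = "\<lambda>t. infnorm (Y x' t - Y x t)" and a = "\<lambda>s. s"
        and b = "\<lambda>_. t" and z = z and R = R])
    fix s assume "s \<in> {0..t}"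
    then have s: "s \<in> {0..\<tau>}" and st: "0 \<le> s" "s \<le> t" using t by auto
    show "z integrable_on {s..t}"
      unfolding z_def using s t by (intro flow_diff_integrable x) auto
    show "l1 (z s) \<le> 0 + D * infnorm (Y x' s - Y x s)"
      unfolding z_def using lip [OF Y_in [OF x(1) s] Y_in [OF x(2) s]] by simp
    have "z integrable_on {0..t}"
      unfolding z_def using t by (intro flow_diff_integrable x) auto
    then have combine: "integral {0..t} z = integral {0..s} z + integral {s..t} z"
      by (rule Henstock_Kurzweil_Integration.integral_combine [OF st, symmetric])
    have "Y x' s - Y x s = (Y x' t - Y x t) + - integral {s..t} z"
      by (simp add: flow_diff_eq [OF x s, folded z_def] flow_diff_eq [OF x t, folded z_def] combine)
    also have "infnorm \<dots> \<le> infnorm (Y x' t - Y x t) + l1 (integral {s..t} z)"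
      using infnorm_triangle [of "Y x' t - Y x t" "- integral {s..t} z"] infnorm_le_l1 [of "- integral {s..t} z"]
      by simp
    finally show "infnorm (Y x' s - Y x s) \<le> infnorm (Y x' t - Y x t) + l1 (integral {s..t} z)" .
  qed (use R t infnorm_pos_le in auto)
  moreover have "Y x' 0 - Y x 0 = x' - x"
    using flow_diff_eq [OF x, of 0] t by simp
  ultimately show ?thesis by simp
qed

(* The partial derivatives of V are controlled only inside M, so the trajectories have to stay off
   the boundary of M; this follows from invariance of domain. *)
lemma flow_in_interior:
  assumes "open S" and x: "x \<in> S" and t: "t \<in> {0..\<tau>}"
  shows "Y x t \<in> interior M"
proof -
  have "(2 * sqrt DIM(real^'n))-lipschitz_on S (\<lambda>x. Y x t)"
  proof (rule lipschitz_onI)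
    fix x y assume xy: "x \<in> S" "y \<in> S"
    have "dist (Y x t) (Y y t) \<le> sqrt DIM(real^'n) * infnorm (Y x t - Y y t)"
      unfolding dist_norm by (rule norm_le_infnorm)
    also have "\<dots> \<le> sqrt DIM(real^'n) * (2 * norm (x - y))"
      using flow_lipschitz [OF xy(2,1) t] infnorm_le_norm [of "x - y"] by (intro mult_left_mono) auto
    finally show "dist (Y x t) (Y y t) \<le> 2 * sqrt DIM(real^'n) * dist x y"
      by (simp add: dist_norm mult_ac)
  qed simp
  then have "continuous_on S (\<lambda>x. Y x t)"
    by (rule lipschitz_on_continuous_on)
  moreover have "inj_on (\<lambda>x. Y x t) S"
  proof (rule inj_onI)
    fix x y assume "x \<in> S" "y \<in> S" "Y x t = Y y t"
    then have "infnorm (x - y) \<le> 0"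
      using flow_expansive [of y x t] t by (simp add: infnorm_0)
    then show "x = y" using infnorm_pos_lt [of "x - y"] by (auto simp: not_less)
  qed
  ultimately have "open ((\<lambda>x. Y x t) ` S)"
    using \<open>open S\<close> by (intro invariance_of_domain)
  moreover have "(\<lambda>x. Y x t) ` S \<subseteq> M"
    using Y_in t by auto
  ultimately show ?thesis
    using interior_maximal x by blast
qed

end

section \<open>Extension from the interior to M, and the theorem\<close>

text \<open>The condition on a pair of points is closed by continuity of \<open>V\<close>. Thus the
  bound from the interior of \<open>M\<close> reaches \<open>M\<close>, before anything is known
  about where in \<open>M\<close> the trajectories run.\<close>

lemma l1_lipschitz_closure:
  fixes V :: "real^'n \<Rightarrow> real^'n"
  assumes "continuous_on UNIV V"
    and "\<And>a b. a \<in> U \<Longrightarrow> b \<in> U \<Longrightarrow> l1 (V b - V a) \<le> D * infnorm (b - a)"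
    and "a \<in> closure U" "b \<in> closure U"
  shows "l1 (V b - V a) \<le> D * infnorm (b - a)"
proof -
  let ?C = "{(a, b). l1 (V b - V a) \<le> D * infnorm (b - a)}"
  have V: "continuous_on UNIV (\<lambda>z. V (f z))" if "continuous_on UNIV f" for f :: "(real^'n) \<times> (real^'n) \<Rightarrow> _"
    using continuous_on_compose2 [OF assms(1) that] by simp
  have "closed ?C"
    unfolding case_prod_beta
    by (intro closed_Collect_le continuous_intros V)
  moreover have "U \<times> U \<subseteq> ?C" using assms(2) by auto
  ultimately have "closure (U \<times> U) \<subseteq> ?C" by (intro closure_minimal)
  with assms(3,4) show ?thesis by (auto simp: closure_Times)
qed

lemma locally_Lipschitz_imp_continuous:
  fixes V :: "'a::euclidean_space \<Rightarrow> 'b::metric_space"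
  assumes "locally_Lipschitz V"
  shows "continuous_on UNIV V"
proof (rule continuous_at_imp_continuous_on, rule ballI)
  fix x
  obtain r L where r: "0 < r" and L: "L-lipschitz_on (cball x r) V"
    using assms unfolding locally_Lipschitz_def by blast
  have "continuous_on (cball x r) V" by (rule lipschitz_on_continuous_on [OF L])
  then show "isCont V x"
    by (rule continuous_on_interior) (use r in simp)
qed

text \<open>Division in \<open>ennreal\<close> has 1/0 = \<infinity>, which is the convention in the
  definition of \<tau>; the minimum with \<open>t0\<close> keeps the value finite.\<close>

lemma time_horizon:
  fixes t0 \<tau> :: real
  assumes "D < (\<infinity> :: ennreal)" "0 < t0" and \<tau>: "\<tau> = enn2real (min (1 / (2 * D)) (ennreal t0))"
  shows "0 \<le> \<tau>" "\<tau> \<le> t0" "enn2real D * \<tau> \<le> 1/2"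
proof -
  define d where "d = enn2real D"
  have d: "0 \<le> d" "D = ennreal d" using assms(1) by (auto simp: d_def)
  show "0 \<le> \<tau>" by (simp add: \<tau>)
  show "\<tau> \<le> t0" using assms(2) unfolding \<tau> by (intro enn2real_leI) auto
  show "enn2real D * \<tau> \<le> 1/2"
  proof (cases "d = 0")
    case True
    then show ?thesis using d_def by simp
  next
    case False
    with d have "0 < d" by simp
    have "1 / (2 * D) = ennreal (1 / (2 * d))"
      using \<open>0 < d\<close> divide_ennreal [of 1 "2 * d"] by (simp add: d(2) ennreal_mult)
    then have "\<tau> \<le> 1 / (2 * d)"
      unfolding \<tau> using \<open>0 < d\<close> by (intro enn2real_leI) auto
    then show ?thesis using \<open>0 < d\<close> by (simp add: d_def [symmetric] field_simps)
  qed
qed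

lemma Dsupn_le_Cnorm: "1 \<le> j \<Longrightarrow> j \<le> m \<Longrightarrow> Dsupn j V M \<le> Cnorm m V M"
  unfolding Cnorm_def by (intro add_increasing member_le_sum) auto

theorem proposition3p3:
  fixes P :: "'w measure"
    and X :: "real \<Rightarrow> 'w \<Rightarrow> real^'n"
    and V :: "real^'n \<Rightarrow> real^'n"
    and Y :: "real^'n \<Rightarrow> real \<Rightarrow> 'w \<Rightarrow> real^'n"
    and K M :: "(real^'n) set"
    and t0 \<tau> :: real
  assumes "prob_space P"
    and "\<forall>i. levy_process P (\<lambda>t \<omega>. X t \<omega> $ i)"
    and "\<forall>\<omega>\<in>space P. X 0 \<omega> = 0"
    and "locally_Lipschitz V"
    and "\<forall>x. \<forall>\<omega>\<in>space P.
           solution_upto (\<lambda>t. X t \<omega>) V x (explosion_time (\<lambda>t. X t \<omega>) V x) (\<lambda>t. Y x t \<omega>)"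
    and "0 < t0"
    and "\<forall>x. \<forall>\<omega>\<in>space P. explosion_time (\<lambda>t. X t \<omega>) V x = \<infinity>"
    and "convex M"
    and "\<forall>x\<in>enlarge K 3. \<forall>t. 0 \<le> t \<and> t \<le> t0 \<longrightarrow> (\<forall>\<omega>\<in>space P. Y x t \<omega> \<in> M)"
    and "partials_exist_upto 3 V M"
    and "Cnorm 3 V M < \<infinity>"
    and "\<tau> = enn2real (min (1 / (2 * Dsupn 1 V M)) (ennreal t0))"
  shows "\<forall>\<omega>\<in>space P.
    (\<forall>t x h. 0 < t \<and> t \<le> \<tau> \<and> x \<in> enlarge K 2 \<and> infnorm h < 1 \<longrightarrow>
       infnorm (Y (x + h) t \<omega> - Y x t \<omega>) \<le> 2 * infnorm h) \<and>
    (\<forall>t x i. 0 < t \<and> t \<le> \<tau> \<and> x \<in> enlarge K 2 \<longrightarrow>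
       partial_exists i (\<lambda>z. Y z t \<omega>) x \<and>
       infnorm (partial i (\<lambda>z. Y z t \<omega>) x) \<le> 2) \<and>
    (\<forall>t x h i. 0 < t \<and> t \<le> \<tau> \<and> x \<in> enlarge K 1 \<and> infnorm h < 1 \<longrightarrow>
       infnorm (partial i (\<lambda>z. Y z t \<omega>) (x + h) - partial i (\<lambda>z. Y z t \<omega>) x)
         \<le> 8 * enn2real (Dsupn 2 V M) * \<tau> * infnorm h) \<and>
    (\<forall>t x i k. 0 < t \<and> t \<le> \<tau> \<and> x \<in> enlarge K 1 \<longrightarrow>
       partial_exists k (partial i (\<lambda>z. Y z t \<omega>)) x \<and>
       infnorm (partial k (partial i (\<lambda>z. Y z t \<omega>)) x) \<le> 8 * enn2real (Dsupn 2 V M) * \<tau>) \<and>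
    (\<forall>t x h i k. 0 < t \<and> t \<le> \<tau> \<and> x \<in> K \<and> infnorm h < 1 \<longrightarrow>
       infnorm (partial k (partial i (\<lambda>z. Y z t \<omega>)) (x + h)
                - partial k (partial i (\<lambda>z. Y z t \<omega>)) x)
         \<le> 96 * (enn2real (Dsupn 2 V M))\<^sup>2 * \<tau>\<^sup>2 * infnorm h
           + 16 * enn2real (Dsupn 3 V M) * \<tau> * infnorm h)"
proof (cases "K = {}")
  \<comment> \<open>Without points in \<open>K\<close> the interior of \<open>M\<close> could be
    empty and the closure argument would fail; here all claims are vacuous.\<close>
  case True
  then show ?thesis by (simp add: enlarge_def)
next
  case False
  show ?thesis
  proof (rule ballI)
    fix \<omega> assume \<omega>: "\<omega> \<in> space P"
    define y where "y x t = Y x t \<omega>" for x t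
    define D where "D j = enn2real (Dsupn j V M)" for j
    define U where "U = interior M"
    have fin: "Dsupn j V M < \<infinity>" if "1 \<le> j" "j \<le> 3" for j
      using Dsupn_le_Cnorm [OF that, of V M] assms(11) by (rule le_less_trans)
    note \<tau> = time_horizon [OF fin [of 1] assms(6,12), simplified]
    have D_nonneg: "0 \<le> D j" for j by (simp add: D_def)
    have sol: "(\<lambda>s. V (y x s)) absolutely_integrable_on {0..t}"
        "y x t = x + X t \<omega> + integral {0..t} (\<lambda>s. V (y x s))" if "0 \<le> t" for x t
      using assms(5,7) \<omega> that by (auto simp: solution_upto_def y_def)
    note y_int = set_lebesgue_integral_eq_integral(1) [OF sol(1)]
    have y_M: "y x t \<in> M" if "x \<in> enlarge K 3" "t \<in> {0..\<tau>}" for x t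
      using assms(9) \<omega> that \<tau>(2) by (auto simp: y_def)
    \<comment> \<open>At time 0 the invariance hypothesis says that K_3 itself lies in
      \<open>M\<close>. As K_3 is open and nonempty, \<open>M\<close> has interior points, and a
      convex set with interior points lies in the closure of its interior.\<close>
    have "y x 0 = x" for x
      using sol(2) [of 0 x] assms(3) \<omega> by simp
    then have "enlarge K 3 \<subseteq> M"
      using y_M [of _ 0] \<tau>(1) by auto
    then have "enlarge K 3 \<subseteq> U"
      unfolding U_def by (intro interior_maximal open_enlarge)
    with False have "interior M \<noteq> {}"
      using subset_enlarge [of 3 K] by (auto simp: U_def)
    then have M_closure: "M \<subseteq> closure U"
      unfolding U_def using convex_closure_interior [OF \<open>convex M\<close>] closure_subset by blast
    have U: "open U" "convex U" "U \<subseteq> M"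
      using \<open>convex M\<close> by (auto simp: U_def interior_subset)
    note Dvec_lip = Dvec_lipschitz [OF assms(10) fin _ U]
    note Dvec_tay = Dvec_taylor [OF assms(10) fin _ U]
    have Dvec_V: "Dvec [] V a = V a" if "a \<in> U" for a
      using Dvec_Nil [OF assms(10)] U(3) that by blast
    have V_lip_U: "l1 (V b - V a) \<le> D 1 * infnorm (b - a)" if "a \<in> U" "b \<in> U" for a b
      using Dvec_lip [of "[]" a b] that by (simp add: D_def Dvec_V)
    have V_lip: "l1 (V b - V a) \<le> D 1 * infnorm (b - a)" if "a \<in> M" "b \<in> M" for a b
      by (rule l1_lipschitz_closure [OF locally_Lipschitz_imp_continuous [OF assms(4)] V_lip_U])
        (use that M_closure in auto)
    have D\<tau>: "D 1 * \<tau> \<le> 1/2" using \<tau>(3) by (simp add: D_def)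
    note flow = D_nonneg [of 1] D\<tau> V_lip y_M y_int [OF \<tau>(1)]
    have eq: "y x t = x + X t \<omega> + integral {0..t} (\<lambda>s. V (y x s))" if "x \<in> enlarge K 3" "t \<in> {0..\<tau>}" for x t
      using sol(2) that(2) by auto
    \<comment> \<open>One constant serves both Taylor remainders: that of V, governed by the second
      derivatives, and that of DV, governed by the third.\<close>
    define C where "C = 2 * D 2 * real CARD('n) + 2 * D 3 * real CARD('n)"
    have C: "2 * D 2 * real CARD('n) \<le> C" "2 * D 3 * real CARD('n) \<le> C" "0 \<le> C"
      using D_nonneg by (auto simp: C_def)
    \<comment> \<open>The head of the list is differentiated last, so D_l D_k V is
      \<open>Dvec [l, k] V\<close>.\<close>
    interpret variational_flow V "\<lambda>k. Dvec [k] V" "\<lambda>k l. Dvec [l, k] V" U K "D 1" "D 2" "D 3" C \<tau> y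
    proof
      show "l1 (V b - V a - (\<Sum>k\<in>UNIV. (b - a) $ k *\<^sub>R Dvec [k] V a)) \<le> C * (infnorm (b - a))\<^sup>2"
        if "a \<in> U" "b \<in> U" for a b
        using Dvec_tay [of "[]" a b] that mult_right_mono [OF C(1), of "(infnorm (b - a))\<^sup>2"]
        by (simp add: D_def Dvec_V numeral_2_eq_2)
      show "l1 (Dvec [k] V b - Dvec [k] V a - (\<Sum>l\<in>UNIV. (b - a) $ l *\<^sub>R Dvec [l, k] V a))
          \<le> C * (infnorm (b - a))\<^sup>2"
        if "a \<in> U" "b \<in> U" for k a b
        using Dvec_tay [of "[k]" a b] that mult_right_mono [OF C(2), of "(infnorm (b - a))\<^sup>2"]
        by (simp add: D_def numeral_3_eq_3)
      show "l1 (\<Sum>k\<in>UNIV. v $ k *\<^sub>R Dvec [k] V a) \<le> D 1 * infnorm v" if "a \<in> U" for a v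
        using l1_sum_Dvec_le [OF assms(10) fin, of "[]" a v] that U(3) by (auto simp: D_def)
      show "l1 (\<Sum>l\<in>UNIV. v $ l *\<^sub>R Dvec [l, k] V a) \<le> D 2 * infnorm v" if "a \<in> U" for k a v
        using l1_sum_Dvec_le [OF assms(10) fin, of "[k]" a v] that U(3) by (auto simp: D_def numeral_2_eq_2)
      show "l1 (Dvec [k] V b - Dvec [k] V a) \<le> D 2 * infnorm (b - a)" if "a \<in> U" "b \<in> U" for k a b
        using Dvec_lip [of "[k]" a b] that by (simp add: D_def numeral_2_eq_2)
      show "l1 (Dvec [l, k] V b - Dvec [l, k] V a) \<le> D 3 * infnorm (b - a)" if "a \<in> U" "b \<in> U" for k l a b
        using Dvec_lip [of "[l, k]" a b] that by (simp add: D_def numeral_3_eq_3)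
      show "y x t \<in> U" if "x \<in> enlarge K 3" "t \<in> {0..\<tau>}" for x t
        unfolding U_def by (rule flow_in_interior [OF flow eq open_enlarge that])
      show "y x' t - y x t = (x' - x) + integral {0..t} (\<lambda>s. V (y x' s) - V (y x s))"
        if "x \<in> enlarge K 3" "x' \<in> enlarge K 3" "t \<in> {0..\<tau>}" for x x' t
        by (rule flow_diff_eq [OF flow eq that])
      show "infnorm (y x' t - y x t) \<le> 2 * infnorm (x' - x)"
        if "x \<in> enlarge K 3" "x' \<in> enlarge K 3" "t \<in> {0..\<tau>}" for x x' t
        by (rule flow_lipschitz [OF flow eq that])
    qed (use D_nonneg C D\<tau> \<tau>(1) y_int in auto)
    have step: "x + h \<in> enlarge K (r + 1)" if "x \<in> enlarge K r" "infnorm h < 1" for x h r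
      using enlarge_add [OF that(1), of h 1] that(2) by simp
    have K1: "K \<subseteq> enlarge K 1" by (rule subset_enlarge) simp
    have K12: "enlarge K 1 \<subseteq> enlarge K 2" and K23: "enlarge K 2 \<subseteq> enlarge K 3"
      by (rule enlarge_mono, simp)+
    have "infnorm (y (x + h) t - y x t) \<le> 2 * infnorm h"
      if "0 < t" "t \<le> \<tau>" "x \<in> enlarge K 2" "infnorm h < 1" for t x h
      using Y_lip [of x "x + h" t] step [OF that(3,4)] that K23 by auto
    moreover have "partial_exists i (\<lambda>z. y z t) x \<and> infnorm (partial i (\<lambda>z. y z t) x) \<le> 2"
      if "0 < t" "t \<le> \<tau>" "x \<in> enlarge K 2" for t x i
      using partial_exists_Y [OF that(3), of t i] J_le [OF that(3), of t i] that(1,2)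
        infnorm_le_l1 [of "J i x t"] by (simp add: J_def)
    moreover have "infnorm (partial i (\<lambda>z. y z t) (x + h) - partial i (\<lambda>z. y z t) x) \<le> 8 * D 2 * \<tau> * infnorm h"
      if "0 < t" "t \<le> \<tau>" "x \<in> enlarge K 1" "infnorm h < 1" for t x h i
      using J_diff_le [of x "x + h" t i] step [OF that(3,4)] that K12
        infnorm_le_l1 [of "J i (x + h) t - J i x t"] by (auto simp: J_def)
    moreover have "partial_exists k (partial i (\<lambda>z. y z t)) x \<and>
        infnorm (partial k (partial i (\<lambda>z. y z t)) x) \<le> 8 * D 2 * \<tau>"
      if "0 < t" "t \<le> \<tau>" "x \<in> enlarge K 1" for t x i k
      using partial_exists_J [OF that(3), of t k i] H_le [OF that(3), of t i k] that(1,2)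
        infnorm_le_l1 [of "H i k x t"] by (simp add: J_def H_def)
    moreover have "infnorm (partial k (partial i (\<lambda>z. y z t)) (x + h) - partial k (partial i (\<lambda>z. y z t)) x)
        \<le> 96 * (D 2)\<^sup>2 * \<tau>\<^sup>2 * infnorm h + 16 * D 3 * \<tau> * infnorm h"
      if "0 < t" "t \<le> \<tau>" "x \<in> K" "infnorm h < 1" for t x h i k
    proof -
      have "x + h \<in> enlarge K 1"
        using that by (auto simp: enlarge_def Bstar_def intro!: bexI [of _ x])
      then show ?thesis
        using H_diff_le [of x "x + h" t i k] that K1
          infnorm_le_l1 [of "H i k (x + h) t - H i k x t"] by (auto simp: J_def H_def)
    qed
    ultimately show "(\<forall>t x h. 0 < t \<and> t \<le> \<tau> \<and> x \<in> enlarge K 2 \<and> infnorm h < 1 \<longrightarrow>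
        infnorm (Y (x + h) t \<omega> - Y x t \<omega>) \<le> 2 * infnorm h) \<and>
      (\<forall>t x i. 0 < t \<and> t \<le> \<tau> \<and> x \<in> enlarge K 2 \<longrightarrow>
        partial_exists i (\<lambda>z. Y z t \<omega>) x \<and>
        infnorm (partial i (\<lambda>z. Y z t \<omega>) x) \<le> 2) \<and>
      (\<forall>t x h i. 0 < t \<and> t \<le> \<tau> \<and> x \<in> enlarge K 1 \<and> infnorm h < 1 \<longrightarrow>
        infnorm (partial i (\<lambda>z. Y z t \<omega>) (x + h) - partial i (\<lambda>z. Y z t \<omega>) x)
          \<le> 8 * enn2real (Dsupn 2 V M) * \<tau> * infnorm h) \<and>
      (\<forall>t x i k. 0 < t \<and> t \<le> \<tau> \<and> x \<in> enlarge K 1 \<longrightarrow>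
        partial_exists k (partial i (\<lambda>z. Y z t \<omega>)) x \<and>
        infnorm (partial k (partial i (\<lambda>z. Y z t \<omega>)) x) \<le> 8 * enn2real (Dsupn 2 V M) * \<tau>) \<and>
      (\<forall>t x h i k. 0 < t \<and> t \<le> \<tau> \<and> x \<in> K \<and> infnorm h < 1 \<longrightarrow>
        infnorm (partial k (partial i (\<lambda>z. Y z t \<omega>)) (x + h)
                 - partial k (partial i (\<lambda>z. Y z t \<omega>)) x)
          \<le> 96 * (enn2real (Dsupn 2 V M))\<^sup>2 * \<tau>\<^sup>2 * infnorm h
            + 16 * enn2real (Dsupn 3 V M) * \<tau> * infnorm h)"
      unfolding y_def D_def by blast
  qed
qed

end
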